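(* Consider the space-time NSFR scheme described in the context with correction parameter $c_{DG}$ (i.e. $c=0$, $\mathcal K=\bm 0$). Let $\mathcal F_s$ be built from an entropy conservative two-point spatial flux $\bm f_s(\cdot,\cdot)$ and $\mathcal F_t$ from an entropy conservative two-point temporal flux $\bm f_t(\cdot,\cdot)$, and let these two-point fluxes also be used as the numerical fluxes at interfaces. Impose periodic boundary conditions in space and Dirichlet boundary conditions in time (numerical flux given by $\bm u_0$ at $t=0$, pure upwinding at $t=T$). Then the scheme is entropy preserving: every solution satisfies $$s(\tilde{\bm u}(T))-s(\bm u_0)+\sum_{k=1}^{K_s}\bm 1\,\mathcal W_f\,\mathrm{diag}(\hat{\bm n}_t^-)\Bigl[\llbracket\Phi^r\rrbracket-\llbracket\tilde{\bm v}\rrbracket^T\bm f_t^{*,r}(\tilde{\bm u}^-,\tilde{\bm u}^+)\Bigr]\Big|_{t=0}=0 .$$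
   Context: PDE: $\partial_t \bm u+\partial_x\bm f_s(\bm u)=0$ on $[x_L,x_R]\times[0,T]$, with $N_s$ states, periodic in $x$, $\bm u(x,0)=\bm u_0(x)$, temporal flux $\bm f_t(\bm u)=\bm u$. It admits a convex entropy $s(\bm u)$ with entropy flux $\bm F$, entropy variables $\bm v=\partial s/\partial\bm u$ (invertible map $\bm u\leftrightarrow\bm v$), and potentials $\Phi=\bm v^T\bm u-s$, $\psi=\bm v^T\bm f_s-\bm F$. On each element set $\Phi^r=J_{1D}\Phi$, $\psi^r=J_{1D}\psi$, with $J_{1D}$ the constant of that element defined below. Entropy conservative two-point fluxes are symmetric and consistent, with $(\bm v_i-\bm v_j)^T\bm f_s(\bm u_i,\bm u_j)=\psi_i-\psi_j$ and $(\bm v_i-\bm v_j)^T\bm f_t(\bm u_i,\bm u_j)=\Phi_i-\Phi_j$ for all states. Mesh: the space-time domain is divided into non-overlapping rectangular Cartesian elements $\Omega_m$, arranged in a grid with $K_s$ elements in space and $K_t$ timeslabs in time. Element $m$ has size $\Delta x_m\times\Delta t_m$ and is mapped to $[-1,1]^2$ with coordinates $(\xi,\tau)$ ($\xi$ spatial, $\tau$ temporal). Its Jacobian determinant is $J=J_m=\frac14\Delta x_m\Delta t_m$ and its face Jacobian is $J_{1D}=\frac12\sqrt{\Delta x_m\Delta t_m}$. The element index $m$ is omitted below: all operators, coefficients, $J$ and $J_{1D}$ are local to the element under consideration. Faces: 1 is $\xi=-1$, 2 is $\xi=1$, 3 is $\tau=-1$, 4 is $\tau=1$. The outward unit normal has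 spatial component $\hat n_s=-1,1,0,0$ and temporal component $\hat n_t=0,0,-1,1$ on faces 1,2,3,4. Nodes and bases: vectors are row vectors and $\bm 1$ is a row vector of ones. $\bm\chi$ is the row of $N_{soln}=(p+1)^2$ tensor-product Lagrange polynomials at tensor-product Gauss-Legendre (GL) or Gauss-Lobatto-Legendre (GLL) solution nodes. $\bm\phi$ is the row of $N_q=(p+1+N_{OI})^2$ ($N_{OI}\ge0$) tensor-product Lagrange polynomials at GL or GLL flux quadrature nodes $\bar{\bm\xi}_q$. Each face carries $p+1+N_{OI}$ nodes of the one-dimensional version of the flux quadrature rule; $\bar{\bm\xi}_f$ collects all face nodes. $\mathcal W_q,\mathcal W_f,\mathcal W_{f,i}$ are the diagonal matrices of quadrature weights (volume, all faces, face $i$). Evaluated bases are matrices with rows indexed by nodes. Operators: $\mathcal M=\bm\chi(\bar{\bm\xi}_q)^T\mathcal W_qJ\,\bm\chi(\bar{\bm\xi}_q)$, $L_t=\mathcal M^{-1}\bm\chi(\bar{\bm\xi}_f)^T\mathcal W_f\mathrm{diag}(\hat{\bm n}_t)$, $L_s=\mathcal M^{-1}\bm\chi(\bar{\bm\xi}_f)^T\mathcal W_f\mathrm{diag}(\hat{\bm n}_s)$ and $$(\tilde{\mathcal Q}-\tilde{\mathcal Q}^T)_s=\begin{bmatrix}\mathcal W_q\,\partial_\xi\bm\phi(\bar{\bm\xi}_q)-\partial_\xi\bm\phi(\bar{\bm\xi}_q)^T\mathcal W_q & \bm\phi(\bar{\bm\xi}_f)^T\mathcal W_f\,\mathrm{diag}(\hat{\bm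 n}_s)\\-\mathcal W_f\,\mathrm{diag}(\hat{\bm n}_s)\bm\phi(\bar{\bm\xi}_f)&\bm 0\end{bmatrix},$$ with $(\tilde{\mathcal Q}-\tilde{\mathcal Q}^T)_t$ the same with $\partial_\tau$ and $\hat{\bm n}_t$. Entropy projection: $\hat{\bm v}^T=\Pi_q\bm v(\bm\chi(\bar{\bm\xi}_q)\hat{\bm u}^T)$ with $\Pi_q=\mathcal M^{-1}\bm\chi(\bar{\bm\xi}_q)^T\mathcal W_qJ$; $\tilde{\bm v}=\bm\chi\hat{\bm v}^T$ and $\tilde{\bm u}=\bm u(\tilde{\bm v})$ at volume flux nodes and face nodes. $(\mathcal F_s^r)_{ij}=J_{1D}\bm f_s(\tilde{\bm u}_i,\tilde{\bm u}_j)$, $(\mathcal F_t^r)_{ij}=J_{1D}\bm f_t(\tilde{\bm u}_i,\tilde{\bm u}_j)$, with $i,j$ over all volume flux nodes and face nodes. Scheme (for each element and each state, unknown coefficients $\hat{\bm u}$, $\odot$ the Hadamard product): $$\mathcal M^{-1}[\bm\chi(\bar{\bm\xi}_q)^T\ \bm\chi(\bar{\bm\xi}_f)^T]\left[(\tilde{\mathcal Q}-\tilde{\mathcal Q}^T)_t\odot\mathcal F_t^r\right]\bm 1^T+L_t\bm f_t^{*,r}+\mathcal M^{-1}[\bm\chi(\bar{\bm\xi}_q)^T\ \bm\chi(\bar{\bm\xi}_f)^T]\left[(\tilde{\mathcal Q}-\tilde{\mathcal Q}^T)_s\odot\mathcal F_s^r\right]\bm 1^T+L_s\bm f_s^{*,r}=\bm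 0^T .$$ Numerical fluxes, evaluated pointwise at face nodes: $\bm f_s^{*,r}=J_{1D}\bm f_s(\tilde{\bm u}^-,\tilde{\bm u}^+)$ on every spatial interface (including the periodic one). On internal temporal interfaces, $\bm f_t^{*,r}=J_{1D}\bm f_t(\tilde{\bm u}^-,\tilde{\bm u}^+)$. At $t=0$, $\bm f_t^{*,r}=J_{1D}\bm u_0$. At $t=T$, $\bm f_t^{*,r}=J_{1D}\tilde{\bm u}^-$ (interior value). Notation at $t=0$: $-$ denotes the exterior state given by the Dirichlet data ($\tilde{\bm u}^-=\bm u_0$, $\tilde{\bm v}^-=\bm v(\bm u_0)$ at the face nodes), $+$ the interior entropy-projected value in the first timeslab, $\llbracket a\rrbracket=a^+-a^-$, and $\hat n_t^-=+1$ there; the weights are those of face 3, and in the $k$-th summand $J_{1D}$ is that of the $k$-th element of the first timeslab. The product $\llbracket\tilde{\bm v}\rrbracket^T\bm f_t^{*,r}$ is taken pointwise at face nodes and summed over states. The discrete entropies are $s(\bm u_0)=\sum_{k=1}^{K_s}\bm 1\mathcal W_{f,3}\,J_{1D}\,s(\bm u_0)|_{t=0}$ and $s(\tilde{\bm u}(T))=\sum_{k=1}^{K_s}\bm 1\mathcal W_{f,4}\,J_{1D}\,s(\tilde{\bm u}_f)|_{t=T}$, with $s$ evaluated at the face nodes, and $J_{1D}$ taken from the $k$-th element, of the first and last timeslabs respectively.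
   Formalization: Added assumption: all elements of the first and last timeslabs share one face Jacobian J_1D (uniform Δx, equal first and last slab heights); without it the balance is false, e.g. for a constant solution c with s(c)≠0 and unequal first and last slabs. *)

theory Defs
  imports "HOL-Analysis.Analysis" "HOL-Computational_Algebra.Polynomial"
begin

text \<open>
  States are vectors of type \<open>real ^ 's\<close>, so \<open>N\<^sub>s = CARD('s)\<close>. The set \<open>U\<close> contains the
  admissible states, on which the system is posed (\<open>UNIV\<close> for Burgers' equation, positive density
  and pressure for the Euler equations). The entropy variables \<open>v\<close> are the gradient of \<open>s\<close>,
  and \<open>u \<mapsto> v u\<close> is invertible as a map from \<open>U\<close> onto \<open>v ` U\<close>.
\<close>

definition entropy_system ::
  "(real ^ 's) set \<Rightarrow> (real ^ 's \<Rightarrow> real) \<Rightarrow> (real ^ 's \<Rightarrow> real ^ 's) \<Rightarrow>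
   (real ^ 's \<Rightarrow> real ^ 's) \<Rightarrow> (real ^ 's \<Rightarrow> real) \<Rightarrow> bool" where
  "entropy_system U s v f F \<longleftrightarrow>
     open U \<and> convex U \<and> convex_on U s \<and>
     (\<forall>u\<in>U. (s has_derivative (\<lambda>h. v u \<bullet> h)) (at u)) \<and>
     inj_on v U \<and>
     (\<forall>u\<in>U. \<exists>Df. (f has_derivative Df) (at u) \<and> (F has_derivative (\<lambda>h. v u \<bullet> Df h)) (at u))"

definition temporal_potential ::
  "(real ^ 's \<Rightarrow> real) \<Rightarrow> (real ^ 's \<Rightarrow> real ^ 's) \<Rightarrow> real ^ 's \<Rightarrow> real" where
  "temporal_potential s v u = v u \<bullet> u - s u"

definition spatial_potential ::
  "(real ^ 's \<Rightarrow> real ^ 's) \<Rightarrow> (real ^ 's \<Rightarrow> real ^ 's) \<Rightarrow> (real ^ 's \<Rightarrow> real) \<Rightarrow> real ^ 's \<Rightarrow> real" where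
  "spatial_potential v f F u = v u \<bullet> f u - F u"

definition entropy_conservative_flux ::
  "(real ^ 's) set \<Rightarrow> (real ^ 's \<Rightarrow> real ^ 's) \<Rightarrow> (real ^ 's \<Rightarrow> real ^ 's) \<Rightarrow> (real ^ 's \<Rightarrow> real) \<Rightarrow>
   (real ^ 's \<Rightarrow> real ^ 's \<Rightarrow> real ^ 's) \<Rightarrow> bool" where
  "entropy_conservative_flux U v f pot f2 \<longleftrightarrow>
     (\<forall>a\<in>U. \<forall>b\<in>U. f2 a b = f2 b a) \<and>
     (\<forall>a\<in>U. f2 a a = f a) \<and>
     (\<forall>a\<in>U. \<forall>b\<in>U. (v a - v b) \<bullet> f2 a b = pot a - pot b)"

text \<open>Rodrigues' formula.\<close>

definition legendre :: "nat \<Rightarrow> real poly" where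
  "legendre n = smult (1 / (2 ^ n * fact n)) ((pderiv ^^ n) ([:-1, 0, 1:] ^ n))"

datatype node_family = GL | GLL

fun quadrature_nodes :: "node_family \<Rightarrow> nat \<Rightarrow> real set" where
  "quadrature_nodes GL n = {z. poly (legendre n) z = 0}"
| "quadrature_nodes GLL n = {-1, 1} \<union> {z. poly (pderiv (legendre (n - 1))) z = 0}"

text \<open>
  One-dimensional nodes are labelled by a finite type \<open>'n\<close> with as many elements as there are nodes;
  the labelling itself is immaterial. For \<open>GLL\<close> the predicate is false when \<open>CARD('n) = 1\<close>
  (the node set is then all of \<open>\<real>\<close>), as it should be: a Lobatto rule has at least two nodes.
\<close>

definition is_nodes :: "node_family \<Rightarrow> ('n::finite \<Rightarrow> real) \<Rightarrow> bool" where
  "is_nodes fam x \<longleftrightarrow> bij_betw x UNIV (quadrature_nodes fam CARD('n))"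

definition lagrange :: "('n::finite \<Rightarrow> real) \<Rightarrow> 'n \<Rightarrow> real poly" where
  "lagrange x i = (\<Prod>j\<in>UNIV - {i}. smult (1 / (x i - x j)) [:- x j, 1:])"

definition weight :: "('n::finite \<Rightarrow> real) \<Rightarrow> 'n \<Rightarrow> real" where
  "weight x i = integral {-1..1} (poly (lagrange x i))"

datatype face = Xi_minus | Xi_plus | Tau_minus | Tau_plus

instance face :: finite
proof
  have "(UNIV :: face set) = {Xi_minus, Xi_plus, Tau_minus, Tau_plus}"
    using face.exhaust by auto
  then show "finite (UNIV :: face set)"
    by (metis finite.emptyI finite.insertI)
qed

fun normal_s :: "face \<Rightarrow> real" where
  "normal_s Xi_minus = -1" | "normal_s Xi_plus = 1" | "normal_s Tau_minus = 0" | "normal_s Tau_plus = 0"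

fun normal_t :: "face \<Rightarrow> real" where
  "normal_t Xi_minus = 0" | "normal_t Xi_plus = 0" | "normal_t Tau_minus = -1" | "normal_t Tau_plus = 1"

text \<open>
  Throughout, \<open>'p\<close> labels the one-dimensional solution nodes (\<open>CARD('p) = p + 1\<close>) and \<open>'q\<close> the
  one-dimensional flux nodes (\<open>CARD('q) = p + 1 + N\<^sub>O\<^sub>I\<close>). Volume flux nodes are labelled by
  \<open>'q \<times> 'q\<close>, face nodes by \<open>face \<times> 'q\<close>, and all of them together by the sum type.
\<close>

type_synonym 'q all_nodes = "('q \<times> 'q) + (face \<times> 'q)"

fun volume_node :: "('q \<Rightarrow> real) \<Rightarrow> 'q \<times> 'q \<Rightarrow> real \<times> real" where
  "volume_node x (a, b) = (x a, x b)"

fun face_node :: "('q \<Rightarrow> real) \<Rightarrow> face \<times> 'q \<Rightarrow> real \<times> real" where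
  "face_node x (Xi_minus, b) = (-1, x b)"
| "face_node x (Xi_plus, b) = (1, x b)"
| "face_node x (Tau_minus, b) = (x b, -1)"
| "face_node x (Tau_plus, b) = (x b, 1)"

fun basis :: "('n::finite \<Rightarrow> real) \<Rightarrow> 'n \<times> 'n \<Rightarrow> real \<times> real \<Rightarrow> real" where
  "basis x (i, j) (\<xi>, \<tau>) = poly (lagrange x i) \<xi> * poly (lagrange x j) \<tau>"

fun basis_dxi :: "('n::finite \<Rightarrow> real) \<Rightarrow> 'n \<times> 'n \<Rightarrow> real \<times> real \<Rightarrow> real" where
  "basis_dxi x (i, j) (\<xi>, \<tau>) = poly (pderiv (lagrange x i)) \<xi> * poly (lagrange x j) \<tau>"

fun basis_dtau :: "('n::finite \<Rightarrow> real) \<Rightarrow> 'n \<times> 'n \<Rightarrow> real \<times> real \<Rightarrow> real" where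
  "basis_dtau x (i, j) (\<xi>, \<tau>) = poly (lagrange x i) \<xi> * poly (pderiv (lagrange x j)) \<tau>"

definition eval_matrix :: "('j \<Rightarrow> real \<times> real \<Rightarrow> real) \<Rightarrow> ('i \<Rightarrow> real \<times> real) \<Rightarrow> real ^ 'j ^ 'i" where
  "eval_matrix g nd = (\<chi> i j. g j (nd i))"

definition diag :: "('i \<Rightarrow> real) \<Rightarrow> real ^ 'i ^ 'i" where
  "diag d = (\<chi> i j. if i = j then d i else 0)"

definition hadamard :: "real ^ 'j ^ 'i \<Rightarrow> real ^ 'j ^ 'i \<Rightarrow> real ^ 'j ^ 'i" where
  "hadamard A B = (\<chi> i j. A $ i $ j * B $ i $ j)"

definition vstack :: "real ^ 'j ^ 'a \<Rightarrow> real ^ 'j ^ 'b \<Rightarrow> real ^ 'j ^ ('a + 'b)" where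
  "vstack A B = (\<chi> i. case i of Inl a \<Rightarrow> A $ a | Inr b \<Rightarrow> B $ b)"

definition block_matrix ::
  "real ^ 'a ^ 'a \<Rightarrow> real ^ 'b ^ 'a \<Rightarrow> real ^ 'a ^ 'b \<Rightarrow> real ^ 'b ^ 'b \<Rightarrow> real ^ ('a + 'b) ^ ('a + 'b)" where
  "block_matrix A B C D =
     (\<chi> i j. case i of
        Inl a \<Rightarrow> (case j of Inl a' \<Rightarrow> A $ a $ a' | Inr b' \<Rightarrow> B $ a $ b')
      | Inr b \<Rightarrow> (case j of Inl a' \<Rightarrow> C $ b $ a' | Inr b' \<Rightarrow> D $ b $ b'))"

definition weights_vol :: "('q::finite \<Rightarrow> real) \<Rightarrow> real ^ ('q \<times> 'q) ^ ('q \<times> 'q)" where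
  "weights_vol x = diag (\<lambda>(a, b). weight x a * weight x b)"

definition weights_face :: "('q::finite \<Rightarrow> real) \<Rightarrow> real ^ (face \<times> 'q) ^ (face \<times> 'q)" where
  "weights_face x = diag (\<lambda>(_, b). weight x b)"

definition diag_normal :: "(face \<Rightarrow> real) \<Rightarrow> real ^ (face \<times> 'q::finite) ^ (face \<times> 'q)" where
  "diag_normal n = diag (\<lambda>(g, _). n g)"

definition sol_vol :: "('p::finite \<Rightarrow> real) \<Rightarrow> ('q::finite \<Rightarrow> real) \<Rightarrow> real ^ ('p \<times> 'p) ^ ('q \<times> 'q)" where
  "sol_vol y x = eval_matrix (basis y) (volume_node x)"

definition sol_face :: "('p::finite \<Rightarrow> real) \<Rightarrow> ('q::finite \<Rightarrow> real) \<Rightarrow> real ^ ('p \<times> 'p) ^ (face \<times> 'q)" where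
  "sol_face y x = eval_matrix (basis y) (face_node x)"

definition flux_face :: "('q::finite \<Rightarrow> real) \<Rightarrow> real ^ ('q \<times> 'q) ^ (face \<times> 'q)" where
  "flux_face x = eval_matrix (basis x) (face_node x)"

definition mass :: "('p::finite \<Rightarrow> real) \<Rightarrow> ('q::finite \<Rightarrow> real) \<Rightarrow> real \<Rightarrow> real ^ ('p \<times> 'p) ^ ('p \<times> 'p)" where
  "mass y x J = transpose (sol_vol y x) ** (J *\<^sub>R weights_vol x) ** sol_vol y x"

definition projection ::
  "('p::finite \<Rightarrow> real) \<Rightarrow> ('q::finite \<Rightarrow> real) \<Rightarrow> real \<Rightarrow> real ^ ('q \<times> 'q) ^ ('p \<times> 'p)" where
  "projection y x J = matrix_inv (mass y x J) ** transpose (sol_vol y x) ** (J *\<^sub>R weights_vol x)"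

definition lift ::
  "(face \<Rightarrow> real) \<Rightarrow> ('p::finite \<Rightarrow> real) \<Rightarrow> ('q::finite \<Rightarrow> real) \<Rightarrow> real \<Rightarrow> real ^ (face \<times> 'q) ^ ('p \<times> 'p)" where
  "lift n y x J = matrix_inv (mass y x J) ** transpose (sol_face y x) ** weights_face x ** diag_normal n"

text \<open>
  The operator \<open>Q - Q\<^sup>T\<close>, for \<open>(dbasis, n) = (basis_dxi, normal_s)\<close> in space and
  \<open>(basis_dtau, normal_t)\<close> in time.
\<close>

definition skew_operator ::
  "(('q::finite \<Rightarrow> real) \<Rightarrow> 'q \<times> 'q \<Rightarrow> real \<times> real \<Rightarrow> real) \<Rightarrow> (face \<Rightarrow> real) \<Rightarrow> ('q \<Rightarrow> real) \<Rightarrow>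
   real ^ 'q all_nodes ^ 'q all_nodes" where
  "skew_operator dbasis n x =
     (let D = eval_matrix (dbasis x) (volume_node x) in
      block_matrix
        (weights_vol x ** D - transpose D ** weights_vol x)
        (transpose (flux_face x) ** weights_face x ** diag_normal n)
        (- (weights_face x ** diag_normal n ** flux_face x))
        0)"

text \<open>\<open>M\<^sup>-\<^sup>1 [\<chi>(\<xi>\<^sub>q)\<^sup>T \<chi>(\<xi>\<^sub>f)\<^sup>T] [(Q - Q\<^sup>T) \<odot> \<F>] 1\<^sup>T\<close>\<close>

definition volume_term ::
  "(('q::finite \<Rightarrow> real) \<Rightarrow> 'q \<times> 'q \<Rightarrow> real \<times> real \<Rightarrow> real) \<Rightarrow> (face \<Rightarrow> real) \<Rightarrow>
   ('p::finite \<Rightarrow> real) \<Rightarrow> ('q \<Rightarrow> real) \<Rightarrow> real \<Rightarrow> real ^ 'q all_nodes ^ 'q all_nodes \<Rightarrow> real ^ ('p \<times> 'p)" where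
  "volume_term dbasis n y x J FF =
     (matrix_inv (mass y x J) ** transpose (vstack (sol_vol y x) (sol_face y x))) *v
     (hadamard (skew_operator dbasis n x) FF *v (\<chi> _. 1))"

text \<open>
  The coefficients in one element have type \<open>real ^ ('p \<times> 'p) ^ 's\<close>: one coefficient vector for each
  state \<open>r :: 's\<close>.
\<close>

definition volume_state ::
  "('p::finite \<Rightarrow> real) \<Rightarrow> ('q::finite \<Rightarrow> real) \<Rightarrow> real ^ ('p \<times> 'p) ^ 's \<Rightarrow> 'q \<times> 'q \<Rightarrow> real ^ 's" where
  "volume_state y x c i = (\<chi> r. (sol_vol y x *v (c $ r)) $ i)"

definition entropy_coeffs ::
  "(real ^ 's \<Rightarrow> real ^ 's) \<Rightarrow> ('p::finite \<Rightarrow> real) \<Rightarrow> ('q::finite \<Rightarrow> real) \<Rightarrow> real \<Rightarrow>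
   real ^ ('p \<times> 'p) ^ 's \<Rightarrow> real ^ ('p \<times> 'p) ^ 's" where
  "entropy_coeffs v y x J c = (\<chi> r. projection y x J *v (\<chi> i. v (volume_state y x c i) $ r))"

definition projected_entropy_vars ::
  "(real ^ 's \<Rightarrow> real ^ 's) \<Rightarrow> ('p::finite \<Rightarrow> real) \<Rightarrow> ('q::finite \<Rightarrow> real) \<Rightarrow> real \<Rightarrow>
   real ^ ('p \<times> 'p) ^ 's \<Rightarrow> 'q all_nodes \<Rightarrow> real ^ 's" where
  "projected_entropy_vars v y x J c i =
     (\<chi> r. (vstack (sol_vol y x) (sol_face y x) *v (entropy_coeffs v y x J c $ r)) $ i)"

definition projected_state ::
  "(real ^ 's) set \<Rightarrow> (real ^ 's \<Rightarrow> real ^ 's) \<Rightarrow> ('p::finite \<Rightarrow> real) \<Rightarrow> ('q::finite \<Rightarrow> real) \<Rightarrow> real \<Rightarrow>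
   real ^ ('p \<times> 'p) ^ 's \<Rightarrow> 'q all_nodes \<Rightarrow> real ^ 's" where
  "projected_state U v y x J c i = inv_into U v (projected_entropy_vars v y x J c i)"

text \<open>
  Element \<open>(k, m)\<close>, with \<open>k < Ks\<close> and \<open>m < Kt\<close>, is \<open>[X k, X (k+1)] \<times> [Y m, Y (m+1)]\<close>.
\<close>

definition space_time_grid ::
  "real \<Rightarrow> real \<Rightarrow> real \<Rightarrow> nat \<Rightarrow> nat \<Rightarrow> (nat \<Rightarrow> real) \<Rightarrow> (nat \<Rightarrow> real) \<Rightarrow> bool" where
  "space_time_grid xL xR T Ks Kt X Y \<longleftrightarrow>
     0 < Ks \<and> 0 < Kt \<and> X 0 = xL \<and> X Ks = xR \<and> Y 0 = 0 \<and> Y Kt = T \<and>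
     (\<forall>k<Ks. X k < X (Suc k)) \<and> (\<forall>m<Kt. Y m < Y (Suc m))"

definition jac :: "(nat \<Rightarrow> real) \<Rightarrow> (nat \<Rightarrow> real) \<Rightarrow> nat \<Rightarrow> nat \<Rightarrow> real" where
  "jac X Y k m = 1 / 4 * (X (Suc k) - X k) * (Y (Suc m) - Y m)"

definition face_jac :: "(nat \<Rightarrow> real) \<Rightarrow> (nat \<Rightarrow> real) \<Rightarrow> nat \<Rightarrow> nat \<Rightarrow> real" where
  "face_jac X Y k m = 1 / 2 * sqrt ((X (Suc k) - X k) * (Y (Suc m) - Y m))"

definition phys_x :: "(nat \<Rightarrow> real) \<Rightarrow> nat \<Rightarrow> real \<Rightarrow> real" where
  "phys_x X k \<xi> = X k + (1 + \<xi>) / 2 * (X (Suc k) - X k)"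

text \<open>
  In the numerical fluxes \<open>us k m i\<close> is the projected state of element \<open>(k, m)\<close> at node \<open>i\<close>. The face
  nodes of neighbouring elements that carry the same label coincide. The fluxes \<open>f\<^sub>s\<^sup>*\<close> on temporal
  and \<open>f\<^sub>t\<^sup>*\<close> on spatial faces do not enter the scheme, because the corresponding normal component
  vanishes there; they are set to \<open>0\<close>.
\<close>

fun num_flux_s ::
  "(real ^ 's \<Rightarrow> real ^ 's \<Rightarrow> real ^ 's) \<Rightarrow> nat \<Rightarrow> (nat \<Rightarrow> real) \<Rightarrow> (nat \<Rightarrow> real) \<Rightarrow>
   (nat \<Rightarrow> nat \<Rightarrow> 'q all_nodes \<Rightarrow> real ^ 's) \<Rightarrow> nat \<Rightarrow> nat \<Rightarrow> face \<times> 'q \<Rightarrow> real ^ 's" where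
  "num_flux_s fs2 Ks X Y us k m (Xi_minus, b) =
     face_jac X Y k m *\<^sub>R
       fs2 (us k m (Inr (Xi_minus, b))) (us (if k = 0 then Ks - 1 else k - 1) m (Inr (Xi_plus, b)))"
| "num_flux_s fs2 Ks X Y us k m (Xi_plus, b) =
     face_jac X Y k m *\<^sub>R
       fs2 (us k m (Inr (Xi_plus, b))) (us (if Suc k = Ks then 0 else Suc k) m (Inr (Xi_minus, b)))"
| "num_flux_s fs2 Ks X Y us k m (Tau_minus, b) = 0"
| "num_flux_s fs2 Ks X Y us k m (Tau_plus, b) = 0"

fun num_flux_t ::
  "(real ^ 's \<Rightarrow> real ^ 's \<Rightarrow> real ^ 's) \<Rightarrow> (real \<Rightarrow> real ^ 's) \<Rightarrow> ('q \<Rightarrow> real) \<Rightarrow> nat \<Rightarrow>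
   (nat \<Rightarrow> real) \<Rightarrow> (nat \<Rightarrow> real) \<Rightarrow>
   (nat \<Rightarrow> nat \<Rightarrow> 'q all_nodes \<Rightarrow> real ^ 's) \<Rightarrow> nat \<Rightarrow> nat \<Rightarrow> face \<times> 'q \<Rightarrow> real ^ 's" where
  "num_flux_t ft2 u0 x Kt X Y us k m (Tau_minus, b) =
     face_jac X Y k m *\<^sub>R
       (if m = 0 then u0 (phys_x X k (x b))
        else ft2 (us k m (Inr (Tau_minus, b))) (us k (m - 1) (Inr (Tau_plus, b))))"
| "num_flux_t ft2 u0 x Kt X Y us k m (Tau_plus, b) =
     face_jac X Y k m *\<^sub>R
       (if Suc m = Kt then us k m (Inr (Tau_plus, b))
        else ft2 (us k m (Inr (Tau_plus, b))) (us k (Suc m) (Inr (Tau_minus, b))))"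
| "num_flux_t ft2 u0 x Kt X Y us k m (Xi_minus, b) = 0"
| "num_flux_t ft2 u0 x Kt X Y us k m (Xi_plus, b) = 0"

definition flux_matrix ::
  "(real ^ 's \<Rightarrow> real ^ 's \<Rightarrow> real ^ 's) \<Rightarrow> real \<Rightarrow> ('q all_nodes \<Rightarrow> real ^ 's) \<Rightarrow> 's \<Rightarrow>
   real ^ ('q::finite) all_nodes ^ 'q all_nodes" where
  "flux_matrix f2 J1 w r = (\<chi> i j. J1 * f2 (w i) (w j) $ r)"

text \<open>Left-hand side of the scheme for state \<open>r\<close> in element \<open>(k, m)\<close>, with projected states \<open>us\<close>.\<close>

definition residual ::
  "(real ^ 's \<Rightarrow> real ^ 's \<Rightarrow> real ^ 's) \<Rightarrow> (real ^ 's \<Rightarrow> real ^ 's \<Rightarrow> real ^ 's) \<Rightarrow>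
   (real \<Rightarrow> real ^ 's) \<Rightarrow> ('p::finite \<Rightarrow> real) \<Rightarrow> ('q::finite \<Rightarrow> real) \<Rightarrow> nat \<Rightarrow> nat \<Rightarrow>
   (nat \<Rightarrow> real) \<Rightarrow> (nat \<Rightarrow> real) \<Rightarrow> (nat \<Rightarrow> nat \<Rightarrow> 'q all_nodes \<Rightarrow> real ^ 's) \<Rightarrow>
   nat \<Rightarrow> nat \<Rightarrow> 's \<Rightarrow> real ^ ('p \<times> 'p)" where
  "residual fs2 ft2 u0 y x Ks Kt X Y us k m r =
     (let J = jac X Y k m; J1 = face_jac X Y k m in
        volume_term basis_dtau normal_t y x J (flux_matrix ft2 J1 (us k m) r)
      + lift normal_t y x J *v (\<chi> i. num_flux_t ft2 u0 x Kt X Y us k m i $ r)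
      + volume_term basis_dxi normal_s y x J (flux_matrix fs2 J1 (us k m) r)
      + lift normal_s y x J *v (\<chi> i. num_flux_s fs2 Ks X Y us k m i $ r))"

definition grid_projected_state ::
  "(real ^ 's) set \<Rightarrow> (real ^ 's \<Rightarrow> real ^ 's) \<Rightarrow> ('p::finite \<Rightarrow> real) \<Rightarrow> ('q::finite \<Rightarrow> real) \<Rightarrow>
   (nat \<Rightarrow> real) \<Rightarrow> (nat \<Rightarrow> real) \<Rightarrow> (nat \<Rightarrow> nat \<Rightarrow> real ^ ('p \<times> 'p) ^ 's) \<Rightarrow>
   nat \<Rightarrow> nat \<Rightarrow> 'q all_nodes \<Rightarrow> real ^ 's" where
  "grid_projected_state U v y x X Y uh k m = projected_state U v y x (jac X Y k m) (uh k m)"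

text \<open>
  The first two conditions say that the entropy projection is defined: the solution is admissible at
  the volume nodes, and the projected entropy variables lie in the domain \<open>v ` U\<close> of the inverse map.
\<close>

definition is_solution ::
  "(real ^ 's) set \<Rightarrow> (real ^ 's \<Rightarrow> real ^ 's) \<Rightarrow>
   (real ^ 's \<Rightarrow> real ^ 's \<Rightarrow> real ^ 's) \<Rightarrow> (real ^ 's \<Rightarrow> real ^ 's \<Rightarrow> real ^ 's) \<Rightarrow>
   (real \<Rightarrow> real ^ 's) \<Rightarrow> ('p::finite \<Rightarrow> real) \<Rightarrow> ('q::finite \<Rightarrow> real) \<Rightarrow> nat \<Rightarrow> nat \<Rightarrow>
   (nat \<Rightarrow> real) \<Rightarrow> (nat \<Rightarrow> real) \<Rightarrow> (nat \<Rightarrow> nat \<Rightarrow> real ^ ('p \<times> 'p) ^ 's) \<Rightarrow> bool" where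
  "is_solution U v fs2 ft2 u0 y x Ks Kt X Y uh \<longleftrightarrow>
     (\<forall>k<Ks. \<forall>m<Kt.
        (\<forall>i. volume_state y x (uh k m) i \<in> U) \<and>
        (\<forall>i. projected_entropy_vars v y x (jac X Y k m) (uh k m) i \<in> v ` U) \<and>
        (\<forall>r. residual fs2 ft2 u0 y x Ks Kt X Y (grid_projected_state U v y x X Y uh) k m r = 0))"

definition initial_entropy ::
  "(real ^ 's \<Rightarrow> real) \<Rightarrow> (real \<Rightarrow> real ^ 's) \<Rightarrow> ('q::finite \<Rightarrow> real) \<Rightarrow> nat \<Rightarrow>
   (nat \<Rightarrow> real) \<Rightarrow> (nat \<Rightarrow> real) \<Rightarrow> real" where
  "initial_entropy s u0 x Ks X Y =
     (\<Sum>k<Ks. \<Sum>b\<in>UNIV. weight x b * (face_jac X Y k 0 * s (u0 (phys_x X k (x b)))))"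

definition final_entropy ::
  "(real ^ 's \<Rightarrow> real) \<Rightarrow> ('q::finite \<Rightarrow> real) \<Rightarrow> nat \<Rightarrow> nat \<Rightarrow>
   (nat \<Rightarrow> real) \<Rightarrow> (nat \<Rightarrow> real) \<Rightarrow> (nat \<Rightarrow> nat \<Rightarrow> 'q all_nodes \<Rightarrow> real ^ 's) \<Rightarrow> real" where
  "final_entropy s x Ks Kt X Y us =
     (\<Sum>k<Ks. \<Sum>b\<in>UNIV. weight x b * (face_jac X Y k (Kt - 1) * s (us k (Kt - 1) (Inr (Tau_plus, b)))))"

text \<open>
  The term at \<open>t = 0\<close>: the exterior state \<open>-\<close> is the Dirichlet datum, the exterior normal is \<open>+1\<close>.
  The argument \<open>vs k i\<close> is the projected entropy variable of element \<open>(k, 0)\<close> at node \<open>i\<close>.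
\<close>

definition dirichlet_term ::
  "(real ^ 's \<Rightarrow> real) \<Rightarrow> (real ^ 's \<Rightarrow> real ^ 's) \<Rightarrow> (real ^ 's \<Rightarrow> real ^ 's \<Rightarrow> real ^ 's) \<Rightarrow>
   (real \<Rightarrow> real ^ 's) \<Rightarrow> ('q::finite \<Rightarrow> real) \<Rightarrow> nat \<Rightarrow> nat \<Rightarrow> (nat \<Rightarrow> real) \<Rightarrow> (nat \<Rightarrow> real) \<Rightarrow>
   (nat \<Rightarrow> nat \<Rightarrow> 'q all_nodes \<Rightarrow> real ^ 's) \<Rightarrow> (nat \<Rightarrow> 'q all_nodes \<Rightarrow> real ^ 's) \<Rightarrow> real" where
  "dirichlet_term s v ft2 u0 x Ks Kt X Y us vs =
     (\<Sum>k<Ks. \<Sum>b\<in>UNIV.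
        let u_ext = u0 (phys_x X k (x b));
            u_int = us k 0 (Inr (Tau_minus, b));
            v_int = vs k (Inr (Tau_minus, b));
            J1 = face_jac X Y k 0
        in weight x b * 1 *
             ((J1 * temporal_potential s v u_int - J1 * temporal_potential s v u_ext)
              - (v_int - v u_ext) \<bullet> num_flux_t ft2 u0 x Kt X Y us k 0 (Tau_minus, b)))"

text \<open>
  Every element residual is homogeneous in the face Jacobian of its own element, whereas the entropies
  at \<open>t = 0\<close> and \<open>t = T\<close> carry the face Jacobians of the first and the last timeslab. The balance
  therefore fails when these two differ (a constant solution \<open>c\<close> with \<open>s c \<noteq> 0\<close> suffices), and the
  contributions of the two sides of a spatial interface do not cancel when they vary along a timeslab.
  The condition leaves the heights of the intermediate timeslabs arbitrary.
\<close>

definition matching_face_jacs :: "nat \<Rightarrow> nat \<Rightarrow> (nat \<Rightarrow> real) \<Rightarrow> (nat \<Rightarrow> real) \<Rightarrow> bool" where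
  "matching_face_jacs Ks Kt X Y \<longleftrightarrow>
     (\<forall>k<Ks. face_jac X Y k 0 = face_jac X Y 0 0 \<and> face_jac X Y k (Kt - 1) = face_jac X Y 0 0)"

end

theory Submission
  imports Defs
begin

text \<open>
  Test the scheme on each element with the coefficients of the projected entropy variables. At the nodes
  these evaluate to \<open>v\<close> of the projected state, so the two-point condition applies to every pair of nodes.
  In the volume term the flux matrix is weighted with a skew-symmetric operator; the jump condition of an entropy
  conservative flux then replaces the fluxes by potentials weighted with the row sums of this operator
  (\<open>flux_differencing\<close>). Summation by parts makes the row sums vanish at volume nodes and equal to minus
  weight times normal at face nodes. Hence the volume terms collapse to potentials on the faces, and each
  element satisfies a balance of \<open>v \<bullet> f\<^sup>* - potential\<close> over its four faces (\<open>element_entropy_balance\<close>).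

  This balance is homogeneous in the face Jacobian of the element, which can be divided out. What the two
  sides of an interface contribute cancels by symmetry and the jump condition (\<open>interface_cancel\<close>). So the
  sum over the grid (\<open>grid_telescoping\<close>) leaves only the faces at the initial and the final time.

  Testing requires multiplying the residual by the mass matrix, and the scheme is written with \<open>matrix_inv\<close>,
  which is meaningful only for an invertible matrix. That the mass matrix is invertible (\<open>mass_invertible\<close>)
  comes down to the positivity of the quadrature weights, i.e. to the exactness of the Gauss-Legendre and
  Gauss-Lobatto rules, which rests on the orthogonality of Legendre polynomials.
\<close>

section \<open>Polynomials integrated over the reference interval\<close>

definition poly_integral :: "real poly \<Rightarrow> real" where
  "poly_integral g = integral {-1..1} (poly g)"

lemma integrable_poly: "(poly g) integrable_on {a..b::real}"
  by (intro integrable_continuous_interval continuous_intros)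

lemma poly_integral_add: "poly_integral (f + g) = poly_integral f + poly_integral g"
  using integral_add[OF integrable_poly[of f "-1" 1] integrable_poly[of g "-1" 1]]
  by (simp add: poly_integral_def poly_add[abs_def])

lemma poly_integral_smult: "poly_integral (smult c g) = c * poly_integral g"
  by (simp add: poly_integral_def poly_smult[abs_def])

lemma poly_integral_0 [simp]: "poly_integral 0 = 0"
  using poly_integral_smult[of 0 0] by simp

lemma poly_integral_sum: "poly_integral (sum f A) = (\<Sum>i\<in>A. poly_integral (f i))"
  by (induction A rule: infinite_finite_induct) (auto simp: poly_integral_add)

lemma poly_integral_pderiv: "poly_integral (pderiv g) = poly g 1 - poly g (-1)"
proof -
  have "(poly (pderiv g) has_integral (poly g 1 - poly g (-1))) {-1..1}"
    by (rule fundamental_theorem_of_calculus)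
      (auto simp flip: has_real_derivative_iff_has_vector_derivative
        intro: has_field_derivative_at_within poly_DERIV)
  then show ?thesis unfolding poly_integral_def by (rule integral_unique)
qed

lemma poly_integral_by_parts:
  assumes "poly f 1 = 0" "poly f (-1) = 0"
  shows "poly_integral (pderiv f * g) = - poly_integral (f * pderiv g)"
proof -
  have "poly_integral (pderiv (f * g)) = 0"
    using assms by (simp add: poly_integral_pderiv)
  then show ?thesis by (simp add: pderiv_mult poly_integral_add mult.commute)
qed

lemma poly_integral_pos:
  assumes "g \<noteq> 0" and "\<And>z. -1 \<le> z \<Longrightarrow> z \<le> 1 \<Longrightarrow> 0 \<le> poly g z"
  shows "0 < poly_integral g"
proof -
  have "poly_integral g \<ge> 0"
    unfolding poly_integral_def using assms(2) by (intro integral_nonneg integrable_poly) auto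
  moreover have "poly_integral g \<noteq> 0"
  proof
    assume "poly_integral g = 0"
    then have "\<forall>z\<in>{-1..1}. poly g z = 0"
      using assms(2) integral_eq_0_iff[OF continuous_on_poly[OF continuous_on_id], of "-1" 1 g]
      unfolding poly_integral_def by simp
    then have "{-1..1} \<subseteq> {z. poly g z = 0}" by auto
    then have "finite {-1..1::real}"
      using poly_roots_finite[OF assms(1)] finite_subset by blast
    then show False using infinite_Icc[of "-1::real" 1] by simp
  qed
  ultimately show ?thesis by simp
qed

section \<open>Orthogonality of the node polynomials\<close>

lemma power_dvd_pderiv:
  fixes c p :: "real poly"
  assumes "c ^ Suc m dvd p"
  shows "c ^ m dvd pderiv p"
proof -
  obtain r where r: "p = c ^ Suc m * r" using assms by (elim dvdE)
  have "pderiv p = c ^ m * (c * pderiv r + smult (of_nat (Suc m)) (r * pderiv c))"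
    unfolding r pderiv_mult pderiv_power_Suc by (simp add: algebra_simps del: of_nat_Suc)
  then show ?thesis by simp
qed

lemma power_dvd_iterated_pderiv:
  fixes c p :: "real poly"
  assumes "j \<le> n"
  shows "c ^ (n - j) dvd (pderiv ^^ j) (c ^ n)"
  using assms
proof (induction j)
  case (Suc j)
  then have "c ^ Suc (n - Suc j) dvd (pderiv ^^ j) (c ^ n)" by (simp add: Suc_diff_Suc)
  then show ?case using power_dvd_pderiv by auto
qed auto

lemma iterated_pderiv_power_root:
  fixes c :: "real poly"
  assumes "poly c z = 0" "j < n"
  shows "poly ((pderiv ^^ j) (c ^ n)) z = 0"
proof -
  have "c dvd c ^ (n - j)" using assms(2) by (simp add: dvd_power)
  also have "\<dots> dvd (pderiv ^^ j) (c ^ n)" using assms(2) by (intro power_dvd_iterated_pderiv) auto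
  finally show ?thesis using assms(1) by (auto elim!: dvdE)
qed

text \<open>
  Integrate by parts \<open>j\<close> times: all boundary terms vanish because fewer than \<open>n\<close> derivatives
  leave a factor \<open>c\<close> in \<open>c ^ n\<close>, and \<open>j\<close> derivatives annihilate \<open>g\<close>.
\<close>

lemma iterated_pderiv_orthogonal:
  fixes c g :: "real poly"
  assumes "poly c 1 = 0" "poly c (-1) = 0" "j \<le> n" "degree g < j"
  shows "poly_integral ((pderiv ^^ j) (c ^ n) * g) = 0"
  using assms(3,4)
proof (induction j arbitrary: g)
  case (Suc j)
  have "poly_integral ((pderiv ^^ Suc j) (c ^ n) * g) = - poly_integral ((pderiv ^^ j) (c ^ n) * pderiv g)"
    using poly_integral_by_parts iterated_pderiv_power_root assms(1,2) Suc.prems(1) by simp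
  also have "\<dots> = 0"
  proof (cases "pderiv g = 0")
    case False
    then have "degree g \<noteq> 0" by (simp add: pderiv_eq_0_iff)
    then show ?thesis using Suc by (simp add: degree_pderiv)
  qed simp
  finally show ?case .
qed simp

lemma legendre_orthogonal:
  assumes "degree g < n"
  shows "poly_integral (legendre n * g) = 0"
  using iterated_pderiv_orthogonal[of "[:-1, 0, 1:]" n n g] assms
  by (simp add: legendre_def poly_integral_smult)

lemma degree_iterated_pderiv:
  fixes g :: "real poly"
  shows "degree ((pderiv ^^ j) g) = degree g - j"
  by (induction j) (auto simp: degree_pderiv)

lemma degree_legendre: "degree (legendre n) = n"
  by (simp add: legendre_def degree_iterated_pderiv degree_power_eq)

text \<open>
  The polynomial \<open>(z\<^sup>2 - 1) * P'\<^bsub>n+1\<^esub>\<close> vanishes exactly at the Lobatto points. One integration by parts,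
  without boundary terms thanks to the factor \<open>z\<^sup>2 - 1\<close>, moves the derivative away from \<open>P\<^bsub>n+1\<^esub>\<close>
  and reduces the claim to the orthogonality of the Legendre polynomials.
\<close>

lemma lobatto_orthogonal:
  assumes "degree g < n"
  shows "poly_integral ([:-1, 0, 1:] * pderiv (legendre (Suc n)) * g) = 0"
proof -
  let ?w = "[:-1, 0, 1:] :: real poly"
  have "degree (?w * g) \<le> Suc (Suc (degree g))"
    using degree_mult_le[of ?w g] by simp
  then have "degree (pderiv (?w * g)) < Suc n"
    using assms by (simp add: degree_pderiv del: mult_pCons_left)
  then have "poly_integral (pderiv (?w * g) * legendre (Suc n)) = 0"
    by (subst mult.commute) (rule legendre_orthogonal)
  then have "poly_integral (?w * g * pderiv (legendre (Suc n))) = 0"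
    using poly_integral_by_parts[of "?w * g" "legendre (Suc n)"] by simp
  then show ?thesis by (simp add: mult.commute mult.left_commute del: mult_pCons_left mult_pCons_right)
qed

section \<open>Interpolatory quadrature and positivity of the weights\<close>

lemma poly_lagrange:
  assumes "inj x"
  shows "poly (lagrange x i) (x j) = (if i = j then 1 else 0)"
proof (cases "i = j")
  case True
  then show ?thesis using assms
    by (simp add: lagrange_def poly_prod inj_eq flip: diff_divide_distrib)
next
  case False
  then have "j \<in> UNIV - {i}" by auto
  then have "(\<Prod>k\<in>UNIV - {i}. (x j - x k) / (x i - x k)) = 0"
    by (intro prod_zero) (auto intro!: bexI[of _ j])
  then show ?thesis using False by (simp add: lagrange_def poly_prod diff_divide_distrib)
qed

lemma degree_lagrange: "degree (lagrange x (i::'n::finite)) < CARD('n)"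
proof -
  have "degree (lagrange x i) \<le> (\<Sum>j\<in>UNIV - {i}. degree (smult (1 / (x i - x j)) [:- x j, 1:]))"
    unfolding lagrange_def by (rule order.trans[OF degree_prod_sum_le]) (auto simp: o_def)
  also have "\<dots> \<le> (\<Sum>j\<in>UNIV - {i}. 1)" by (intro sum_mono) auto
  also have "\<dots> < CARD('n)" by (simp add: card_Diff_singleton)
  finally show ?thesis .
qed

lemma poly_eq_0_at_nodes:
  fixes x :: "'n::finite \<Rightarrow> real"
  assumes "inj x" "degree g < CARD('n)" "\<And>i. poly g (x i) = 0"
  shows "g = 0"
proof (rule ccontr)
  assume "g \<noteq> 0"
  have "CARD('n) = card (range x)" using assms(1) by (simp add: card_image)
  also have "\<dots> \<le> card {z. poly g z = 0}"
    using assms(3) poly_roots_finite[OF \<open>g \<noteq> 0\<close>] by (intro card_mono) auto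
  also have "\<dots> \<le> degree g" using \<open>g \<noteq> 0\<close> by (rule card_poly_roots_bound)
  finally show False using assms(2) by simp
qed

lemma lagrange_interpolation:
  fixes x :: "'n::finite \<Rightarrow> real"
  assumes "inj x" "degree g < CARD('n)"
  shows "(\<Sum>i\<in>UNIV. smult (poly g (x i)) (lagrange x i)) = g"
proof -
  let ?r = "(\<Sum>i\<in>UNIV. smult (poly g (x i)) (lagrange x i)) - g"
  have "degree (\<Sum>i\<in>UNIV. smult (poly g (x i)) (lagrange x i)) \<le> CARD('n) - 1"
  proof (rule degree_sum_le)
    fix i
    show "degree (smult (poly g (x i)) (lagrange x i)) \<le> CARD('n) - 1"
      using degree_smult_le[of "poly g (x i)" "lagrange x i"] degree_lagrange[of x i] by linarith
  qed simp
  then have "degree ?r < CARD('n)"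
    using assms(2) degree_diff_le[of _ "CARD('n) - 1" g] zero_less_card_finite
    by (metis (no_types, lifting) Suc_pred' less_Suc_eq_le)
  moreover have "poly ?r (x i) = 0" for i
    by (simp add: poly_sum poly_lagrange[OF assms(1)] if_distrib sum.delta cong: if_cong)
  ultimately have "?r = 0" using poly_eq_0_at_nodes[OF assms(1)] by blast
  then show ?thesis by simp
qed

lemma quadrature_exact_interpolatory:
  fixes x :: "'n::finite \<Rightarrow> real"
  assumes "inj x" "degree g < CARD('n)"
  shows "(\<Sum>i\<in>UNIV. weight x i * poly g (x i)) = poly_integral g"
proof -
  have "poly_integral g = (\<Sum>i\<in>UNIV. poly_integral (smult (poly g (x i)) (lagrange x i)))"
    by (subst lagrange_interpolation[OF assms, symmetric]) (simp add: poly_integral_sum)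
  then show ?thesis by (simp add: poly_integral_smult weight_def mult.commute flip: poly_integral_def)
qed

text \<open>
  Gauss's argument: if the node polynomial \<open>A\<close> is orthogonal to all polynomials of degree below
  \<open>m\<close>, then dividing by \<open>A\<close> changes neither the quadrature sum nor the integral, and the rule gains
  \<open>m\<close> degrees of exactness over plain interpolation.
\<close>

lemma quadrature_exact:
  fixes x :: "'n::finite \<Rightarrow> real"
  assumes "inj x" "degree A = CARD('n)" "\<And>i. poly A (x i) = 0"
    and orth: "\<And>h. degree h < m \<Longrightarrow> poly_integral (A * h) = 0"
    and "degree g < CARD('n) + m"
  shows "(\<Sum>i\<in>UNIV. weight x i * poly g (x i)) = poly_integral g"
proof -
  have "A \<noteq> 0" using assms(2) by auto
  have g: "g = A * (g div A) + g mod A" by simp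
  have "degree (g mod A) < CARD('n)"
    using degree_mod_less[OF \<open>A \<noteq> 0\<close>, of g] assms(2) by auto
  then have "(\<Sum>i\<in>UNIV. weight x i * poly (g mod A) (x i)) = poly_integral (g mod A)"
    by (rule quadrature_exact_interpolatory[OF assms(1)])
  moreover have "poly (g mod A) (x i) = poly g (x i)" for i
  proof -
    have "poly g (x i) = poly A (x i) * poly (g div A) (x i) + poly (g mod A) (x i)"
      by (subst g) (simp only: poly_add poly_mult)
    then show ?thesis using assms(3) by simp
  qed
  moreover have "poly_integral (A * (g div A)) = 0"
  proof (cases "g div A = 0")
    case False
    then have AB: "degree (A * (g div A)) = CARD('n) + degree (g div A)"
      using assms(2) \<open>A \<noteq> 0\<close> by (simp add: degree_mult_eq)
    then have "degree g = degree (A * (g div A))"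
      using degree_add_eq_left[of "g mod A" "A * (g div A)"] \<open>degree (g mod A) < CARD('n)\<close> by simp
    then have "degree (g div A) < m" using assms(5) AB by linarith
    then show ?thesis by (rule orth)
  qed simp
  ultimately show ?thesis
    using poly_integral_add[of "A * (g div A)" "g mod A"] by simp
qed

lemma is_nodes_inj: "is_nodes fam x \<Longrightarrow> inj x"
  by (auto simp: is_nodes_def bij_betw_def)

lemma gauss_quadrature_exact:
  fixes x :: "'n::finite \<Rightarrow> real"
  assumes "is_nodes GL x" "degree g < 2 * CARD('n)"
  shows "(\<Sum>i\<in>UNIV. weight x i * poly g (x i)) = poly_integral g"
proof (rule quadrature_exact[where A = "legendre CARD('n)" and m = "CARD('n)"])
  show "inj x" using assms(1) by (rule is_nodes_inj)
  show "poly (legendre CARD('n)) (x i) = 0" for i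
    using assms(1) by (auto simp: is_nodes_def bij_betw_def)
qed (use assms(2) in \<open>auto simp: degree_legendre legendre_orthogonal\<close>)

text \<open>
  With a single node, the set of Lobatto nodes would be all of \<open>\<real>\<close>, because \<open>P\<^sub>0' = 0\<close>.
\<close>

lemma lobatto_node_count:
  fixes x :: "'n::finite \<Rightarrow> real"
  assumes "is_nodes GLL x"
  shows "2 \<le> CARD('n)"
proof (rule ccontr)
  assume "\<not> 2 \<le> CARD('n)"
  then have "CARD('n) = 1" using zero_less_card_finite[where 'a = 'n] by linarith
  then have "range x = UNIV"
    using assms degree_legendre[of 0]
    by (auto simp: is_nodes_def bij_betw_def pderiv_eq_0_iff[THEN iffD2])
  then show False
    using infinite_UNIV_char_0[where 'a = real] finite_imageI[of UNIV x] by simp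
qed

lemma lobatto_quadrature_exact:
  fixes x :: "'n::finite \<Rightarrow> real"
  assumes "is_nodes GLL x" "degree g < 2 * CARD('n) - 2"
  shows "(\<Sum>i\<in>UNIV. weight x i * poly g (x i)) = poly_integral g"
proof -
  obtain n where n: "CARD('n) = Suc (Suc n)"
    using lobatto_node_count[OF assms(1)] by (metis le_Suc_ex add_2_eq_Suc)
  let ?A = "[:-1, 0, 1:] * pderiv (legendre (Suc n))"
  have "pderiv (legendre (Suc n)) \<noteq> 0" by (simp add: pderiv_eq_0_iff degree_legendre)
  then have deg: "degree ?A = CARD('n)"
    by (subst degree_mult_eq) (auto simp: degree_pderiv degree_legendre n)
  show ?thesis
  proof (rule quadrature_exact[where A = ?A and m = n])
    show "inj x" using assms(1) by (rule is_nodes_inj)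
    have "x i \<in> quadrature_nodes GLL CARD('n)" for i
      using assms(1) unfolding is_nodes_def bij_betw_def by blast
    then have node: "x i = 1 \<or> x i = -1 \<or> poly (pderiv (legendre (Suc n))) (x i) = 0" for i
      by (auto simp: n)
    show "poly ?A (x i) = 0" for i
      using node[of i] unfolding poly_mult by (elim disjE) simp_all
  qed (use assms(2) deg lobatto_orthogonal in \<open>auto simp: n simp del: mult_pCons_left\<close>)
qed

text \<open>
  The square of a Lagrange polynomial is integrated exactly and its quadrature sum is the weight.
\<close>

lemma weight_pos_GL:
  assumes "is_nodes GL x"
  shows "0 < weight x i"
proof -
  let ?l = "lagrange x i"
  have inj: "inj x" using assms by (auto intro: is_nodes_inj)
  have "?l \<noteq> 0" using poly_lagrange[OF inj, of i i] by auto
  have "degree (?l * ?l) < 2 * CARD('a)"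
    using degree_mult_le[of ?l ?l] degree_lagrange[of x i] by linarith
  then have "(\<Sum>j\<in>UNIV. weight x j * poly (?l * ?l) (x j)) = poly_integral (?l * ?l)"
    by (rule gauss_quadrature_exact[OF assms])
  also have "(\<Sum>j\<in>UNIV. weight x j * poly (?l * ?l) (x j)) = weight x i"
    by (simp add: poly_lagrange[OF inj] if_distrib cong: if_cong)
  also have "0 < poly_integral (?l * ?l)"
    using \<open>?l \<noteq> 0\<close> by (intro poly_integral_pos) auto
  finally show ?thesis .
qed

text \<open>
  The Lobatto rule misses the degree of \<open>l\<^sub>i\<^sup>2\<close> by one. If a linear \<open>u\<close>, nonnegative on the interval, vanishes at
  a node \<open>z\<close> other than \<open>x i\<close>, then \<open>l\<^sub>i = u * h\<close>, and the polynomial \<open>l\<^sub>i * h = u * h\<^sup>2\<close> is still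
  nonnegative but has one degree less. Its quadrature sum is \<open>weight x i * h (x i)\<close>, where
  \<open>h (x i) = 1 / u (x i)\<close>.
\<close>

lemma lobatto_weight_div_pos:
  fixes x :: "'n::finite \<Rightarrow> real"
  assumes "is_nodes GLL x" and "poly u z = 0" "degree u = 1" "z \<in> range x" "z \<noteq> x i"
    and nonneg: "\<And>t. -1 \<le> t \<Longrightarrow> t \<le> 1 \<Longrightarrow> 0 \<le> poly u t"
  shows "0 < weight x i / poly u (x i)"
proof -
  let ?l = "lagrange x i"
  have inj: "inj x" using assms by (auto intro: is_nodes_inj)
  have "u \<noteq> 0" using assms(3) by auto
  have "poly ?l z = 0" using assms(4,5) poly_lagrange[OF inj, of i] by auto
  have "u dvd ?l"
  proof -
    have "[:-z, 1:] dvd u" using assms(2) by (simp add: poly_eq_0_iff_dvd)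
    then obtain c where c: "u = [:-z, 1:] * c" by (elim dvdE)
    then have "degree c = 0" using assms(3) \<open>u \<noteq> 0\<close> by (auto simp: degree_mult_eq simp del: mult_pCons_left)
    then obtain a where "c = [:a:]" by (elim degree_eq_zeroE)
    then have "u = smult a [:-z, 1:]" "a \<noteq> 0" using c \<open>u \<noteq> 0\<close> by auto
    moreover have "[:-z, 1:] dvd ?l" using \<open>poly ?l z = 0\<close> by (simp add: poly_eq_0_iff_dvd)
    ultimately show ?thesis by (metis smult_dvd)
  qed
  then obtain h where h: "?l = u * h" by (elim dvdE)
  have one: "poly u (x i) * poly h (x i) = 1"
    using poly_lagrange[OF inj, of i i] h by simp
  then have "h \<noteq> 0" by auto
  have "degree (u * h) = 1 + degree h"
    using \<open>u \<noteq> 0\<close> \<open>h \<noteq> 0\<close> assms(3) by (simp add: degree_mult_eq)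
  then have "degree (?l * h) < 2 * CARD('n) - 2"
    using degree_lagrange[of x i] \<open>h \<noteq> 0\<close> \<open>u \<noteq> 0\<close> h by (simp add: degree_mult_eq)
  then have "(\<Sum>j\<in>UNIV. weight x j * poly (?l * h) (x j)) = poly_integral (?l * h)"
    by (rule lobatto_quadrature_exact[OF assms(1)])
  also have "(\<Sum>j\<in>UNIV. weight x j * poly (?l * h) (x j)) = weight x i * poly h (x i)"
  proof -
    have "weight x j * poly (?l * h) (x j) = (if i = j then weight x i * poly h (x i) else 0)" for j
      by (simp add: poly_lagrange[OF inj])
    then show ?thesis by simp
  qed
  also have "0 < poly_integral (?l * h)"
    using nonneg \<open>u \<noteq> 0\<close> \<open>h \<noteq> 0\<close> unfolding h by (intro poly_integral_pos) (auto simp: mult.assoc)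
  finally show ?thesis using one by (simp add: divide_inverse inverse_unique)
qed

text \<open>
  For an interior node the preceding lemma applies to \<open>u = 1 + z\<close> and to \<open>u = 1 - z\<close>. So the weight has
  the same sign as \<open>1 + x i\<close> and as \<open>1 - x i\<close>, hence as their sum \<open>2\<close>. This avoids having to locate
  the roots of \<open>P'\<close> inside the interval.
\<close>

lemma weight_pos_GLL:
  assumes "is_nodes GLL x"
  shows "0 < weight x i"
proof -
  have r: "1 \<in> range x" "-1 \<in> range x"
    using assms unfolding is_nodes_def bij_betw_def by auto
  have plus: "0 < weight x i / (1 + x i)" if "x i \<noteq> -1"
    using lobatto_weight_div_pos[OF assms, of "[:1, 1:]" "-1" i] that r by auto
  have minus: "0 < weight x i / (1 - x i)" if "x i \<noteq> 1"
    using lobatto_weight_div_pos[OF assms, of "[:1, -1:]" 1 i] that r by auto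
  consider "x i = 1" | "x i = -1" | "x i \<noteq> 1" "x i \<noteq> -1" by blast
  then show ?thesis
  proof cases
    case 3
    then show ?thesis using plus minus by (auto simp: zero_less_divide_iff)
  qed (use plus minus in auto)
qed

lemma weight_pos: "is_nodes fam x \<Longrightarrow> 0 < weight x i"
  by (cases fam) (auto simp: weight_pos_GL weight_pos_GLL)

section \<open>Invertibility of the mass matrix\<close>

text \<open>
  The polynomial with nodal values \<open>d\<close> on the solution nodes has degree below \<open>CARD('p)\<close>, so it vanishes
  when it vanishes at the at least as many flux nodes.
\<close>

lemma lagrange_independent:
  fixes y :: "'p::finite \<Rightarrow> real" and x :: "'q::finite \<Rightarrow> real"
  assumes "inj y" "inj x" "CARD('p) \<le> CARD('q)"
    and zero: "\<And>a. (\<Sum>i\<in>UNIV. d i * poly (lagrange y i) (x a)) = 0"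
  shows "d i = 0"
proof -
  let ?g = "\<Sum>i\<in>UNIV. smult (d i) (lagrange y i)"
  have "degree ?g \<le> CARD('p) - 1"
  proof (rule degree_sum_le)
    fix i
    show "degree (smult (d i) (lagrange y i)) \<le> CARD('p) - 1"
      using degree_smult_le[of "d i" "lagrange y i"] degree_lagrange[of y i] by linarith
  qed simp
  then have "degree ?g < CARD('q)"
    using assms(3) zero_less_card_finite[where 'a = 'q] by linarith
  then have "?g = 0"
    by (rule poly_eq_0_at_nodes[OF assms(2)]) (simp add: poly_sum zero)
  moreover have "poly ?g (y i) = d i"
    by (simp add: poly_sum poly_lagrange[OF assms(1)] if_distrib cong: if_cong)
  ultimately show ?thesis by simp
qed

lemma sum_UNIV_prod: "(\<Sum>i\<in>UNIV. f i) = (\<Sum>a\<in>UNIV. \<Sum>b\<in>UNIV. f (a, b))"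
  for f :: "'a::finite \<times> 'b::finite \<Rightarrow> 'c::comm_monoid_add"
  by (simp add: sum.cartesian_product)

lemma sum_UNIV_Plus: "(\<Sum>i\<in>UNIV. f i) = (\<Sum>a\<in>UNIV. f (Inl a)) + (\<Sum>b\<in>UNIV. f (Inr b))"
  for f :: "'a::finite + 'b::finite \<Rightarrow> 'c::comm_monoid_add"
  by (simp add: sum.Plus flip: UNIV_Plus_UNIV)

lemma sum_UNIV_face:
  "(\<Sum>g\<in>UNIV. f g) = f Xi_minus + f Xi_plus + f Tau_minus + f Tau_plus"
  for f :: "face \<Rightarrow> 'c::comm_monoid_add"
proof -
  have "(UNIV :: face set) = {Xi_minus, Xi_plus, Tau_minus, Tau_plus}"
    using face.exhaust by auto
  then show ?thesis unfolding \<open>UNIV = _\<close> by (simp add: ac_simps)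
qed

lemma diag_mult_vector: "(diag d *v z) $ i = d i * z $ i"
  by (simp add: diag_def matrix_vector_mult_def if_distrib[of "\<lambda>t. t * _"] cong: if_cong)

lemma diag_mult_matrix: "(diag d ** A) $ i $ j = d i * A $ i $ j"
  by (simp add: diag_def matrix_matrix_mult_def if_distrib[of "\<lambda>t. t * _"] cong: if_cong)

lemma matrix_mult_diag: "(A ** diag d) $ i $ j = A $ i $ j * d j"
  by (simp add: diag_def matrix_matrix_mult_def if_distrib[of "\<lambda>t. _ * t"] cong: if_cong)

lemma diag_mult_diag: "diag d ** diag e = diag (\<lambda>i. d i * e i)"
  by (simp add: vec_eq_iff diag_mult_matrix) (simp add: diag_def)

lemma inner_transpose_mult: "c \<bullet> (transpose A *v z) = (A *v c) \<bullet> z"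
  for A :: "real ^ 'n ^ 'm"
  by (simp add: transpose_matrix_vector inner_commute[of c] dot_lmul_matrix inner_commute[of z])

lemma vstack_mult_vector:
  "(vstack A B *v c) $ i = (case i of Inl a \<Rightarrow> (A *v c) $ a | Inr b \<Rightarrow> (B *v c) $ b)"
  by (cases i) (simp_all add: vstack_def matrix_vector_mult_def)

lemma sol_vol_injective:
  fixes y :: "'p::finite \<Rightarrow> real" and x :: "'q::finite \<Rightarrow> real"
  assumes "inj y" "inj x" "CARD('p) \<le> CARD('q)" "sol_vol y x *v c = 0"
  shows "c = 0"
proof -
  have "(\<Sum>i\<in>UNIV. (\<Sum>j\<in>UNIV. c $ (i, j) * poly (lagrange y j) (x b)) * poly (lagrange y i) (x a)) = 0"
    for a b
  proof -
    have "(sol_vol y x *v c) $ (a, b) = 0" using assms(4) by simp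
    then show ?thesis
      by (simp add: sol_vol_def eval_matrix_def matrix_vector_mult_def sum_UNIV_prod sum_distrib_left
          mult_ac)
  qed
  then have "(\<Sum>j\<in>UNIV. c $ (i, j) * poly (lagrange y j) (x b)) = 0" for i b
    by (rule lagrange_independent[OF assms(1-3)])
  then have "c $ (i, j) = 0" for i j
    by (rule lagrange_independent[OF assms(1-3)])
  then show ?thesis by (auto simp: vec_eq_iff)
qed

text \<open>
  The quadratic form of the mass matrix is \<open>J\<close> times a weighted sum of squares of values at the flux
  nodes. The weights are positive, and a polynomial that vanishes at all flux nodes is zero.
\<close>

lemma mass_invertible:
  fixes y :: "'p::finite \<Rightarrow> real" and x :: "'q::finite \<Rightarrow> real"
  assumes "is_nodes sol_family y" "is_nodes flux_family x" "CARD('p) \<le> CARD('q)" "J \<noteq> 0"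
  shows "invertible (mass y x J)"
proof -
  have inj: "inj y" "inj x" using assms is_nodes_inj by auto
  have "c = 0" if c: "mass y x J *v c = 0" for c
  proof -
    let ?z = "sol_vol y x *v c"
    have "0 = c \<bullet> (mass y x J *v c)" using c by simp
    also have "\<dots> = ?z \<bullet> ((J *\<^sub>R weights_vol x) *v ?z)"
      by (simp add: mass_def inner_transpose_mult del: transpose_matrix_vector flip: matrix_vector_mul_assoc)
    also have "\<dots> = J * (\<Sum>i\<in>UNIV. (weight x (fst i) * weight x (snd i)) * (?z $ i)\<^sup>2)"
      by (simp add: scaleR_matrix_vector_assoc[symmetric] inner_vec_def weights_vol_def diag_mult_vector
          sum_distrib_left case_prod_beta power2_eq_square mult_ac)
    finally have sum_zero: "(\<Sum>i\<in>UNIV. (weight x (fst i) * weight x (snd i)) * (?z $ i)\<^sup>2) = 0"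
      using assms(4) by simp
    have w: "0 < weight x (fst i) * weight x (snd i)" for i
      using weight_pos[OF assms(2)] by simp
    have "(weight x (fst i) * weight x (snd i)) * (?z $ i)\<^sup>2 = 0" for i
      by (rule sum_nonneg_0[OF finite _ sum_zero]) (use less_imp_le[OF w] in simp_all)
    then have "?z $ i = 0" for i
      using w[of i] by (metis less_irrefl mult_eq_0_iff zero_eq_power2)
    then have "?z = 0" by (simp add: vec_eq_iff)
    then show ?thesis by (rule sol_vol_injective[OF inj assms(3)])
  qed
  then show ?thesis by (simp add: invertible_left_inverse matrix_left_invertible_ker)
qed

section \<open>The skew-symmetric flux differencing operators\<close>

lemma skew_operator_entries:
  "skew_operator dbasis n x $ Inl (a, b) $ Inl (a', b') =
     weight x a * weight x b * dbasis x (a', b') (x a, x b)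
     - weight x a' * weight x b' * dbasis x (a, b) (x a', x b')"
  "skew_operator dbasis n x $ Inl i $ Inr (g, b) = weight x b * n g * basis x i (face_node x (g, b))"
  "skew_operator dbasis n x $ Inr (g, b) $ Inl i = - (weight x b * n g * basis x i (face_node x (g, b)))"
  "skew_operator dbasis n x $ Inr f $ Inr f' = 0"
  by (simp_all add: skew_operator_def block_matrix_def Let_def weights_vol_def weights_face_def
      diag_normal_def flux_face_def eval_matrix_def transpose_def diag_mult_matrix matrix_mult_diag
      diag_mult_diag matrix_mul_assoc[symmetric] mult_ac)

lemma skew_operator_skew:
  "skew_operator dbasis n x $ i $ j = - skew_operator dbasis n x $ j $ i"
  by (cases i; cases j) (auto simp: skew_operator_entries)

lemma sum_lagrange:
  assumes "inj x"
  shows "(\<Sum>i\<in>UNIV. poly (lagrange x i) z) = 1"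
    and "(\<Sum>i\<in>UNIV. poly (pderiv (lagrange x i)) z) = 0"
proof -
  have 1: "(\<Sum>i\<in>UNIV. lagrange x i) = 1"
    using lagrange_interpolation[OF assms, of 1] by simp
  show "(\<Sum>i\<in>UNIV. poly (lagrange x i) z) = 1"
    using arg_cong[OF 1, of "\<lambda>q. poly q z"] by (simp add: poly_sum)
  show "(\<Sum>i\<in>UNIV. poly (pderiv (lagrange x i)) z) = 0"
    using arg_cong[OF 1, of "\<lambda>q. poly (pderiv q) z"] by (simp add: poly_sum higher_pderiv_sum[of 1, simplified])
qed

lemma sum_weight_lagrange:
  assumes "inj x"
  shows "(\<Sum>j\<in>UNIV. weight x j * poly (lagrange x i) (x j)) = weight x i"
  by (simp add: poly_lagrange[OF assms] if_distrib cong: if_cong)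

text \<open>
  The one-dimensional summation-by-parts identity tested against the constant \<open>1\<close>: the derivative has
  degree below \<open>CARD('n)\<close>, so interpolatory exactness suffices.
\<close>

lemma sum_weight_pderiv_lagrange:
  fixes x :: "'n::finite \<Rightarrow> real"
  assumes "inj x"
  shows "(\<Sum>j\<in>UNIV. weight x j * poly (pderiv (lagrange x i)) (x j))
    = poly (lagrange x i) 1 - poly (lagrange x i) (-1)"
proof -
  have "degree (pderiv (lagrange x i)) < CARD('n)"
    using degree_lagrange[of x i] by (simp add: degree_pderiv)
  then show ?thesis
    using quadrature_exact_interpolatory[OF assms] poly_integral_pderiv by metis
qed

text \<open>
  The basis functions add up to \<open>1\<close>, so extrapolating a constant to a face reproduces it.
\<close>

lemma skew_row_sum_face:
  assumes "inj x"
  shows "(\<Sum>j\<in>UNIV. skew_operator dbasis n x $ Inr (g, b) $ j) = - (weight x b * n g)"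
proof -
  have "(\<Sum>i\<in>UNIV. basis x i z) = 1" for z
    by (cases z) (simp add: sum_UNIV_prod sum_lagrange[OF assms] flip: sum_distrib_left)
  then show ?thesis
    by (simp add: sum_UNIV_Plus skew_operator_entries sum_negf flip: sum_distrib_left)
qed

text \<open>
  The row sum consists of the derivative of the constant \<open>1\<close>, which is \<open>0\<close>, minus the volume quadrature of
  \<open>\<partial>\<^sub>\<xi> \<phi>\<close> plus the surface quadrature of \<open>n\<^sub>s \<phi>\<close>. The last two agree by summation by parts in
  \<open>\<xi>\<close>; in the other direction both of them use the same nodal quadrature.
\<close>

lemma skew_row_sum_volume_xi:
  assumes "inj x"
  shows "(\<Sum>j\<in>UNIV. skew_operator basis_dxi normal_s x $ Inl (a, b) $ j) = 0"
proof -
  let ?l = "\<lambda>i. poly (lagrange x i)" and ?d = "\<lambda>i. poly (pderiv (lagrange x i))"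
  have 1: "(\<Sum>a'\<in>UNIV. \<Sum>b'\<in>UNIV. weight x a * weight x b * (?d a' (x a) * ?l b' (x b))) = 0"
    by (simp add: sum_lagrange[OF assms] flip: sum_distrib_left sum_distrib_right)
  have "(\<Sum>a'\<in>UNIV. \<Sum>b'\<in>UNIV. weight x a' * weight x b' * (?d a (x a') * ?l b (x b')))
    = (\<Sum>a'\<in>UNIV. weight x a' * ?d a (x a')) * (\<Sum>b'\<in>UNIV. weight x b' * ?l b (x b'))"
    unfolding sum_product by (intro sum.cong) auto
  also have "\<dots> = (?l a 1 - ?l a (-1)) * weight x b"
    by (simp only: sum_weight_lagrange[OF assms] sum_weight_pderiv_lagrange[OF assms])
  finally have 2: "(\<Sum>a'\<in>UNIV. \<Sum>b'\<in>UNIV. weight x a' * weight x b' * (?d a (x a') * ?l b (x b')))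
    = (?l a 1 - ?l a (-1)) * weight x b" .
  have 3: "(\<Sum>b'\<in>UNIV. weight x b' * (c * ?l b (x b'))) = c * weight x b" for c
    unfolding sum_weight_lagrange[OF assms, of b, symmetric] sum_distrib_left
    by (intro sum.cong refl) (rule mult.left_commute)
  have "(\<Sum>f\<in>UNIV. skew_operator basis_dxi normal_s x $ Inl (a, b) $ Inr f)
    = ?l a 1 * weight x b - ?l a (-1) * weight x b"
    by (simp add: sum_UNIV_prod sum_UNIV_face skew_operator_entries sum_negf 3)
  moreover have "(\<Sum>i\<in>UNIV. skew_operator basis_dxi normal_s x $ Inl (a, b) $ Inl i)
    = - ((?l a 1 - ?l a (-1)) * weight x b)"
    by (simp only: sum_UNIV_prod skew_operator_entries basis_dxi.simps sum_subtractf 1 2 diff_0)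
  ultimately show ?thesis by (simp add: sum_UNIV_Plus left_diff_distrib)
qed

lemma skew_row_sum_volume_tau:
  assumes "inj x"
  shows "(\<Sum>j\<in>UNIV. skew_operator basis_dtau normal_t x $ Inl (a, b) $ j) = 0"
proof -
  let ?l = "\<lambda>i. poly (lagrange x i)" and ?d = "\<lambda>i. poly (pderiv (lagrange x i))"
  have 1: "(\<Sum>a'\<in>UNIV. \<Sum>b'\<in>UNIV. weight x a * weight x b * (?l a' (x a) * ?d b' (x b))) = 0"
    by (simp add: sum_lagrange[OF assms] flip: sum_distrib_left sum_distrib_right)
  have "(\<Sum>a'\<in>UNIV. \<Sum>b'\<in>UNIV. weight x a' * weight x b' * (?l a (x a') * ?d b (x b')))
    = (\<Sum>a'\<in>UNIV. weight x a' * ?l a (x a')) * (\<Sum>b'\<in>UNIV. weight x b' * ?d b (x b'))"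
    unfolding sum_product by (intro sum.cong) auto
  also have "\<dots> = weight x a * (?l b 1 - ?l b (-1))"
    by (simp only: sum_weight_lagrange[OF assms] sum_weight_pderiv_lagrange[OF assms])
  finally have 2: "(\<Sum>a'\<in>UNIV. \<Sum>b'\<in>UNIV. weight x a' * weight x b' * (?l a (x a') * ?d b (x b')))
    = weight x a * (?l b 1 - ?l b (-1))" .
  have 3: "(\<Sum>a'\<in>UNIV. weight x a' * (?l a (x a') * c)) = weight x a * c" for c
    unfolding sum_weight_lagrange[OF assms, of a, symmetric] sum_distrib_right
    by (intro sum.cong refl) (rule mult.assoc[symmetric])
  have "(\<Sum>f\<in>UNIV. skew_operator basis_dtau normal_t x $ Inl (a, b) $ Inr f)
    = weight x a * ?l b 1 - weight x a * ?l b (-1)"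
    by (simp add: sum_UNIV_prod sum_UNIV_face skew_operator_entries sum_negf 3)
  moreover have "(\<Sum>i\<in>UNIV. skew_operator basis_dtau normal_t x $ Inl (a, b) $ Inl i)
    = - (weight x a * (?l b 1 - ?l b (-1)))"
    by (simp only: sum_UNIV_prod skew_operator_entries basis_dtau.simps sum_subtractf 1 2 diff_0)
  ultimately show ?thesis by (simp add: sum_UNIV_Plus right_diff_distrib)
qed

text \<open>
  Exchanging the names of \<open>i\<close> and \<open>j\<close> and using skew-symmetry turns \<open>v i\<close> into half the jump
  \<open>v i - v j\<close>. The two-point condition converts the jump into a difference of potentials, and the same
  exchange read backwards leaves the potentials paired with the row sums.
\<close>

lemma flux_differencing:
  fixes S :: "'i::finite \<Rightarrow> 'i \<Rightarrow> real" and f :: "'i \<Rightarrow> 'i \<Rightarrow> 'a::real_inner"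
  assumes skew: "\<And>i j. S i j = - S j i" and sym: "\<And>i j. f i j = f j i"
    and jump: "\<And>i j. (v i - v j) \<bullet> f i j = pot i - pot j"
  shows "(\<Sum>i\<in>UNIV. \<Sum>j\<in>UNIV. S i j * (v i \<bullet> f i j)) = (\<Sum>i\<in>UNIV. pot i * (\<Sum>j\<in>UNIV. S i j))"
proof -
  let ?L = "\<Sum>i\<in>UNIV. \<Sum>j\<in>UNIV. S i j * (v i \<bullet> f i j)"
  let ?R = "\<Sum>i\<in>UNIV. \<Sum>j\<in>UNIV. S i j * pot i"
  have "?L = (\<Sum>i\<in>UNIV. \<Sum>j\<in>UNIV. S j i * (v j \<bullet> f j i))" by (rule sum.swap)
  also have "\<dots> = (\<Sum>i\<in>UNIV. \<Sum>j\<in>UNIV. - (S i j * (v j \<bullet> f i j)))"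
    by (intro sum.cong refl) (metis skew sym mult_minus_left)
  finally have "2 * ?L = (\<Sum>i\<in>UNIV. \<Sum>j\<in>UNIV. S i j * ((v i - v j) \<bullet> f i j))"
    by (simp add: inner_diff_left right_diff_distrib sum_subtractf sum_negf)
  also have "\<dots> = ?R - (\<Sum>i\<in>UNIV. \<Sum>j\<in>UNIV. S i j * pot j)"
    by (simp add: jump right_diff_distrib sum_subtractf)
  also have "(\<Sum>i\<in>UNIV. \<Sum>j\<in>UNIV. S i j * pot j) = (\<Sum>i\<in>UNIV. \<Sum>j\<in>UNIV. S j i * pot i)"
    by (rule sum.swap)
  also have "\<dots> = - ?R"
    unfolding sum_negf[symmetric] by (intro sum.cong refl) (metis skew mult_minus_left)
  finally have "?L = ?R" by simp
  then show ?thesis by (simp add: sum_distrib_left mult.commute)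
qed

section \<open>Entropy balance of one element\<close>

text \<open>
  Testing the volume term with the coefficients \<open>c\<close> of the entropy variables: transposing the stacked
  bases evaluates \<open>c\<close> at the nodes, where it equals \<open>v (w i)\<close>. The flux differencing identity then
  applies, and since volume rows of the skew operator sum to zero only the potentials on the faces
  remain.
\<close>

lemma sum_inner_volume_term:
  fixes y :: "'p::finite \<Rightarrow> real" and x :: "'q::finite \<Rightarrow> real" and U :: "(real ^ 's::finite) set"
  assumes inj: "inj x" and ec: "entropy_conservative_flux U v f pot f2"
    and w: "\<And>i. w i \<in> U"
    and vw: "\<And>i r. v (w i) $ r = (vstack (sol_vol y x) (sol_face y x) *v c r) $ i"
    and vol: "\<And>i. (\<Sum>j\<in>UNIV. skew_operator dbasis n x $ Inl i $ j) = 0"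
  shows "(\<Sum>r\<in>UNIV. c r \<bullet> (transpose (vstack (sol_vol y x) (sol_face y x)) *v
            (hadamard (skew_operator dbasis n x) (flux_matrix f2 J1 w r) *v (\<chi> _. 1))))
    = - J1 * (\<Sum>g\<in>UNIV. \<Sum>b\<in>UNIV. weight x b * n g * pot (w (Inr (g, b))))"
proof -
  let ?S = "skew_operator dbasis n x"
  let ?V = "vstack (sol_vol y x) (sol_face y x)"
  have "(\<Sum>r\<in>UNIV. c r \<bullet> (transpose ?V *v (hadamard ?S (flux_matrix f2 J1 w r) *v (\<chi> _. 1))))
    = (\<Sum>r\<in>UNIV. \<Sum>i\<in>UNIV. \<Sum>j\<in>UNIV. J1 * (?S $ i $ j * (v (w i) $ r * f2 (w i) (w j) $ r)))"
    unfolding inner_transpose_mult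
    by (simp add: inner_vec_def vw[symmetric] hadamard_def flux_matrix_def matrix_vector_mult_def[of "vec_lambda _"]
        sum_distrib_left mult_ac)
  also have "\<dots> = (\<Sum>i\<in>UNIV. \<Sum>r\<in>UNIV. \<Sum>j\<in>UNIV. J1 * (?S $ i $ j * (v (w i) $ r * f2 (w i) (w j) $ r)))"
    by (rule sum.swap)
  also have "\<dots> = (\<Sum>i\<in>UNIV. \<Sum>j\<in>UNIV. \<Sum>r\<in>UNIV. J1 * (?S $ i $ j * (v (w i) $ r * f2 (w i) (w j) $ r)))"
    by (intro sum.cong refl sum.swap)
  also have "\<dots> = J1 * (\<Sum>i\<in>UNIV. \<Sum>j\<in>UNIV. ?S $ i $ j * (v (w i) \<bullet> f2 (w i) (w j)))"
    by (simp add: inner_vec_def sum_distrib_left)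
  also have "(\<Sum>i\<in>UNIV. \<Sum>j\<in>UNIV. ?S $ i $ j * (v (w i) \<bullet> f2 (w i) (w j)))
    = (\<Sum>i\<in>UNIV. pot (w i) * (\<Sum>j\<in>UNIV. ?S $ i $ j))"
    by (rule flux_differencing[OF skew_operator_skew])
      (use ec w in \<open>auto simp: entropy_conservative_flux_def\<close>)
  also have "\<dots> = - (\<Sum>g\<in>UNIV. \<Sum>b\<in>UNIV. weight x b * n g * pot (w (Inr (g, b))))"
  proof -
    have "(\<Sum>i\<in>UNIV. pot (w i) * (\<Sum>j\<in>UNIV. ?S $ i $ j))
      = (\<Sum>f\<in>UNIV. pot (w (Inr f)) * (\<Sum>j\<in>UNIV. ?S $ Inr f $ j))"
      by (subst sum_UNIV_Plus) (simp only: vol mult_zero_right sum.neutral_const add_0)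
    also have "\<dots> = (\<Sum>g\<in>UNIV. \<Sum>b\<in>UNIV. pot (w (Inr (g, b))) * - (weight x b * n g))"
      unfolding sum_UNIV_prod skew_row_sum_face[OF inj] ..
    finally show ?thesis by (simp add: sum_negf mult_ac)
  qed
  finally show ?thesis by simp
qed

lemma sum_inner_lift:
  fixes y :: "'p::finite \<Rightarrow> real" and x :: "'q::finite \<Rightarrow> real" and vw :: "'q all_nodes \<Rightarrow> real ^ 's::finite"
  assumes vw: "\<And>i r. vw i $ r = (vstack (sol_vol y x) (sol_face y x) *v c r) $ i"
  shows "(\<Sum>r\<in>UNIV. c r \<bullet> (transpose (sol_face y x) *v (weights_face x ** diag_normal n *v (\<chi> i. fl i $ r))))
    = (\<Sum>g\<in>UNIV. \<Sum>b\<in>UNIV. weight x b * n g * (vw (Inr (g, b)) \<bullet> fl (g, b)))"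
proof -
  have face: "(sol_face y x *v c r) $ i = vw (Inr i) $ r" for i r
    by (simp add: vw vstack_mult_vector)
  have "(\<Sum>r\<in>UNIV. c r \<bullet> (transpose (sol_face y x) *v (weights_face x ** diag_normal n *v (\<chi> i. fl i $ r))))
    = (\<Sum>r\<in>UNIV. \<Sum>i\<in>UNIV. vw (Inr i) $ r * ((case i of (g, b) \<Rightarrow> weight x b * n g) * fl i $ r))"
    unfolding inner_transpose_mult
    by (simp add: inner_vec_def face weights_face_def diag_normal_def diag_mult_diag diag_mult_vector case_prod_beta)
  also have "\<dots> = (\<Sum>i\<in>UNIV. \<Sum>r\<in>UNIV. vw (Inr i) $ r * ((case i of (g, b) \<Rightarrow> weight x b * n g) * fl i $ r))"
    by (rule sum.swap)
  finally show ?thesis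
    by (simp add: sum_UNIV_prod inner_vec_def sum_distrib_left mult_ac)
qed

lemma invertible_matrix_inv_cancel:
  fixes A :: "real ^ 'n ^ 'n"
  assumes "invertible A" "matrix_inv A *v z = 0"
  shows "z = 0"
proof -
  have "A ** matrix_inv A = mat 1"
    using someI_ex[OF assms(1)[unfolded invertible_def]] unfolding matrix_inv_def by simp
  then have "z = A *v (matrix_inv A *v z)" by (simp add: matrix_vector_mul_assoc)
  then show ?thesis using assms(2) by simp
qed

text \<open>
  Since the mass matrix is invertible, the factor \<open>M\<^sup>-\<^sup>1\<close> of the residual can be cancelled, and the
  remaining equation is tested with the entropy coefficients. Every element thus carries the discrete
  entropy balance on its boundary alone: the normal-weighted sum of \<open>v \<bullet> f\<^sup>*\<close> minus the potential is zero.
\<close>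

lemma element_entropy_balance:
  fixes y :: "'p::finite \<Rightarrow> real" and x :: "'q::finite \<Rightarrow> real" and U :: "(real ^ 's::finite) set"
    and us :: "nat \<Rightarrow> nat \<Rightarrow> 'q all_nodes \<Rightarrow> real ^ 's"
  assumes inj: "inj x" and inv: "invertible (mass y x (jac X Y k m))"
    and ecs: "entropy_conservative_flux U v fs pots fs2"
    and ect: "entropy_conservative_flux U v ft pott ft2"
    and w: "\<And>i. us k m i \<in> U"
    and vw: "\<And>i r. v (us k m i) $ r = (vstack (sol_vol y x) (sol_face y x) *v c r) $ i"
    and res: "\<And>r. residual fs2 ft2 u0 y x Ks Kt X Y us k m r = 0"
  defines "J1 \<equiv> face_jac X Y k m"
    and "ns \<equiv> num_flux_s fs2 Ks X Y us k m"
    and "nt \<equiv> num_flux_t ft2 u0 x Kt X Y us k m"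
  shows "(\<Sum>g\<in>UNIV. \<Sum>b\<in>UNIV. weight x b * normal_t g *
            (v (us k m (Inr (g, b))) \<bullet> nt (g, b) - J1 * pott (us k m (Inr (g, b)))))
       + (\<Sum>g\<in>UNIV. \<Sum>b\<in>UNIV. weight x b * normal_s g *
            (v (us k m (Inr (g, b))) \<bullet> ns (g, b) - J1 * pots (us k m (Inr (g, b))))) = 0"
proof -
  let ?V = "vstack (sol_vol y x) (sol_face y x)"
  let ?vt = "\<lambda>r. transpose ?V *v (hadamard (skew_operator basis_dtau normal_t x)
    (flux_matrix ft2 J1 (us k m) r) *v (\<chi> _. 1))"
  let ?vs = "\<lambda>r. transpose ?V *v (hadamard (skew_operator basis_dxi normal_s x)
    (flux_matrix fs2 J1 (us k m) r) *v (\<chi> _. 1))"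
  let ?lt = "\<lambda>r. transpose (sol_face y x) *v (weights_face x ** diag_normal normal_t *v (\<chi> i. nt i $ r))"
  let ?ls = "\<lambda>r. transpose (sol_face y x) *v (weights_face x ** diag_normal normal_s *v (\<chi> i. ns i $ r))"
  have "matrix_inv (mass y x (jac X Y k m)) *v (?vt r + ?lt r + ?vs r + ?ls r) = 0" for r
    using res[of r]
    by (simp add: residual_def Let_def volume_term_def lift_def J1_def ns_def nt_def matrix_vector_right_distrib
        matrix_vector_mul_assoc matrix_mul_assoc del: transpose_matrix_vector)
  then have zero: "?vt r + ?lt r + ?vs r + ?ls r = 0" for r
    by (rule invertible_matrix_inv_cancel[OF inv])
  have "0 = (\<Sum>r\<in>UNIV. c r \<bullet> (?vt r + ?lt r + ?vs r + ?ls r))"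
    by (simp only: zero inner_zero_right sum.neutral_const)
  also have "\<dots> = (\<Sum>r\<in>UNIV. c r \<bullet> ?vt r) + (\<Sum>r\<in>UNIV. c r \<bullet> ?lt r)
      + (\<Sum>r\<in>UNIV. c r \<bullet> ?vs r) + (\<Sum>r\<in>UNIV. c r \<bullet> ?ls r)"
    by (simp only: inner_add_right sum.distrib)
  also have "(\<Sum>r\<in>UNIV. c r \<bullet> ?vt r)
    = - J1 * (\<Sum>g\<in>UNIV. \<Sum>b\<in>UNIV. weight x b * normal_t g * pott (us k m (Inr (g, b))))"
    by (rule sum_inner_volume_term[OF inj ect w vw]) (auto simp: skew_row_sum_volume_tau[OF inj])
  also have "(\<Sum>r\<in>UNIV. c r \<bullet> ?vs r)
    = - J1 * (\<Sum>g\<in>UNIV. \<Sum>b\<in>UNIV. weight x b * normal_s g * pots (us k m (Inr (g, b))))"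
    by (rule sum_inner_volume_term[OF inj ecs w vw]) (auto simp: skew_row_sum_volume_xi[OF inj])
  also have "(\<Sum>r\<in>UNIV. c r \<bullet> ?lt r)
    = (\<Sum>g\<in>UNIV. \<Sum>b\<in>UNIV. weight x b * normal_t g * (v (us k m (Inr (g, b))) \<bullet> nt (g, b)))"
    by (rule sum_inner_lift[OF vw])
  also have "(\<Sum>r\<in>UNIV. c r \<bullet> ?ls r)
    = (\<Sum>g\<in>UNIV. \<Sum>b\<in>UNIV. weight x b * normal_s g * (v (us k m (Inr (g, b))) \<bullet> ns (g, b)))"
    by (rule sum_inner_lift[OF vw])
  finally have sum_zero: "0 =
      - J1 * (\<Sum>g\<in>UNIV. \<Sum>b\<in>UNIV. weight x b * normal_t g * pott (us k m (Inr (g, b))))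
      + (\<Sum>g\<in>UNIV. \<Sum>b\<in>UNIV. weight x b * normal_t g * (v (us k m (Inr (g, b))) \<bullet> nt (g, b)))
      + - J1 * (\<Sum>g\<in>UNIV. \<Sum>b\<in>UNIV. weight x b * normal_s g * pots (us k m (Inr (g, b))))
      + (\<Sum>g\<in>UNIV. \<Sum>b\<in>UNIV. weight x b * normal_s g * (v (us k m (Inr (g, b))) \<bullet> ns (g, b)))" .
  have split: "(\<Sum>g\<in>UNIV. \<Sum>b\<in>UNIV. weight x b * n g * (A g b - J1 * P g b))
    = (\<Sum>g\<in>UNIV. \<Sum>b\<in>UNIV. weight x b * n g * A g b)
      - J1 * (\<Sum>g\<in>UNIV. \<Sum>b\<in>UNIV. weight x b * n g * P g b)"
    for n :: "face \<Rightarrow> real" and A P :: "face \<Rightarrow> 'q \<Rightarrow> real"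
    by (simp add: right_diff_distrib sum_subtractf sum_distrib_left mult_ac)
  show ?thesis using sum_zero unfolding split by linarith
qed

section \<open>Summation over the grid\<close>

lemma sum_periodic_shift:
  "(\<Sum>k<N. f (if Suc k = N then 0 else Suc k)) = (\<Sum>k<N. f k)" for f :: "nat \<Rightarrow> 'a::comm_monoid_add"
proof (cases N)
  case (Suc n)
  have "(\<Sum>k<n. f (if Suc k = Suc n then 0 else Suc k)) = (\<Sum>k<n. f (Suc k))"
    by (rule sum.cong) auto
  then have "(\<Sum>k<Suc n. f (if Suc k = Suc n then 0 else Suc k)) = (\<Sum>k<n. f (Suc k)) + f 0"
    by (simp only: sum.lessThan_Suc simp_thms if_True)
  also have "\<dots> = (\<Sum>k<Suc n. f k)"
    unfolding sum.lessThan_Suc_shift by (rule add.commute)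
  finally show ?thesis unfolding Suc .
qed auto

text \<open>
  Summing over a timeslab, periodicity cancels the spatial interfaces, so what leaves through the top of
  a slab entered through its bottom; the top of one slab is the bottom of the next. For this the
  terms of the scheme have to be divided by the face Jacobian, which may change from one slab to another.
\<close>

lemma grid_telescoping:
  fixes top bottom right left :: "nat \<Rightarrow> nat \<Rightarrow> real"
  assumes "0 < Kt"
    and balance: "\<And>k m. k < Ks \<Longrightarrow> m < Kt \<Longrightarrow> top k m - bottom k m + (right k m - left k m) = 0"
    and space: "\<And>k m. k < Ks \<Longrightarrow> m < Kt \<Longrightarrow> right k m = left (if Suc k = Ks then 0 else Suc k) m"
    and time: "\<And>k m. k < Ks \<Longrightarrow> Suc m < Kt \<Longrightarrow> top k m = bottom k (Suc m)"
  shows "(\<Sum>k<Ks. top k (Kt - 1)) = (\<Sum>k<Ks. bottom k 0)"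
proof -
  have slab: "(\<Sum>k<Ks. top k m) = (\<Sum>k<Ks. bottom k m)" if "m < Kt" for m
  proof -
    have "(\<Sum>k<Ks. right k m) = (\<Sum>k<Ks. left k m)"
      using sum_periodic_shift[of "\<lambda>k. left k m" Ks] space[OF _ that] by simp
    moreover have "(\<Sum>k<Ks. top k m - bottom k m + (right k m - left k m)) = 0"
      using balance[OF _ that] by (intro sum.neutral) auto
    ultimately show ?thesis by (simp add: sum.distrib sum_subtractf)
  qed
  have "m < Kt \<Longrightarrow> (\<Sum>k<Ks. top k m) = (\<Sum>k<Ks. bottom k 0)" for m
  proof (induction m)
    case (Suc m)
    have "(\<Sum>k<Ks. top k m) = (\<Sum>k<Ks. bottom k (Suc m))"
      using time Suc.prems by (intro sum.cong) auto
    then show ?case using Suc slab by simp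
  qed (use slab in auto)
  then show ?thesis using assms(1) by simp
qed

text \<open>
  The two sides of an interface contribute equally, because the flux is symmetric and its pairing with the jump
  of \<open>v\<close> is the jump of the potential.
\<close>

lemma interface_cancel:
  assumes "entropy_conservative_flux U v f pot f2" "a \<in> U" "b \<in> U"
  shows "v a \<bullet> f2 a b - pot a = v b \<bullet> f2 b a - pot b"
proof -
  have "(v a - v b) \<bullet> f2 a b = pot a - pot b" "f2 a b = f2 b a"
    using assms by (auto simp: entropy_conservative_flux_def)
  then show ?thesis by (simp add: inner_diff_left)
qed

text \<open>
  After summation over the grid only the faces at \<open>t = 0\<close> and \<open>t = T\<close> are left. At \<open>t = T\<close> upwinding
  gives \<open>v \<bullet> u - \<Phi> u = s u\<close>. At \<open>t = 0\<close> the remaining term is \<open>v \<bullet> u\<^sub>0 - \<Phi> u\<close> with interior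
  \<open>v\<close> and \<open>u\<close>; adding and subtracting \<open>\<Phi> u\<^sub>0 = v u\<^sub>0 \<bullet> u\<^sub>0 - s u\<^sub>0\<close> produces the initial entropy and the
  Dirichlet term.
\<close>

theorem theorem4:
  fixes U :: "(real ^ 's) set"
    and s F :: "real ^ 's \<Rightarrow> real"
    and v fs :: "real ^ 's \<Rightarrow> real ^ 's"
    and fs2 ft2 :: "real ^ 's \<Rightarrow> real ^ 's \<Rightarrow> real ^ 's"
    and u0 :: "real \<Rightarrow> real ^ 's"
    and xL xR T :: real
    and Ks Kt p N_OI :: nat
    and X Y :: "nat \<Rightarrow> real"
    and sol_family flux_family :: node_family
    and y :: "'p::finite \<Rightarrow> real"
    and x :: "'q::finite \<Rightarrow> real"
    and uh :: "nat \<Rightarrow> nat \<Rightarrow> real ^ ('p \<times> 'p) ^ 's"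
  assumes "entropy_system U s v fs F"
    and "entropy_conservative_flux U v fs (spatial_potential v fs F) fs2"
    and "entropy_conservative_flux U v (\<lambda>u. u) (temporal_potential s v) ft2"
    and "space_time_grid xL xR T Ks Kt X Y"
    and "matching_face_jacs Ks Kt X Y"
    and "CARD('p) = p + 1" and "CARD('q) = p + 1 + N_OI"
    and "is_nodes sol_family y" and "is_nodes flux_family x"
    and "\<forall>z\<in>{xL..xR}. u0 z \<in> U" and "u0 xL = u0 xR"
    and "is_solution U v fs2 ft2 u0 y x Ks Kt X Y uh"
  shows "let us = grid_projected_state U v y x X Y uh;
             vs = (\<lambda>k. projected_entropy_vars v y x (jac X Y k 0) (uh k 0))
         in final_entropy s x Ks Kt X Y us - initial_entropy s u0 x Ks X Y
              + dirichlet_term s v ft2 u0 x Ks Kt X Y us vs = 0"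
proof -
  define us where "us = grid_projected_state U v y x X Y uh"
  define vs where "vs = (\<lambda>k. projected_entropy_vars v y x (jac X Y k 0) (uh k 0))"
  let ?\<Phi> = "temporal_potential s v" and ?\<psi> = "spatial_potential v fs F"
  let ?next = "\<lambda>k. if Suc k = Ks then 0 else Suc k" and ?prev = "\<lambda>k. if k = 0 then Ks - 1 else k - 1"
  let ?V = "\<lambda>k m g b. v (us k m (Inr (g, b)))"
  note ecs = assms(2) and ect = assms(3)
  have Kpos: "0 < Ks" "0 < Kt" and dX: "\<And>k. k < Ks \<Longrightarrow> X k < X (Suc k)"
    and dY: "\<And>m. m < Kt \<Longrightarrow> Y m < Y (Suc m)"
    using assms(4) by (auto simp: space_time_grid_def)
  have inj: "inj x" using assms(9) by (rule is_nodes_inj)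
  have proj: "us k m i \<in> U" "v (us k m i) = projected_entropy_vars v y x (jac X Y k m) (uh k m) i"
    if "k < Ks" "m < Kt" for k m i
    using assms(12) that
    by (auto simp: us_def grid_projected_state_def projected_state_def is_solution_def
        inv_into_into f_inv_into_f)

  \<comment> \<open>The contributions of the four faces of an element, divided by its face Jacobian; those of the lower
    and the left face enter the balance with a minus sign, from the outward normal.\<close>
  define top where "top k m = (\<Sum>b\<in>UNIV. weight x b * (?V k m Tau_plus b \<bullet>
      (if Suc m = Kt then us k m (Inr (Tau_plus, b))
       else ft2 (us k m (Inr (Tau_plus, b))) (us k (Suc m) (Inr (Tau_minus, b))))
      - ?\<Phi> (us k m (Inr (Tau_plus, b)))))" for k m
  define bottom where "bottom k m = (\<Sum>b\<in>UNIV. weight x b * (?V k m Tau_minus b \<bullet>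
      (if m = 0 then u0 (phys_x X k (x b))
       else ft2 (us k m (Inr (Tau_minus, b))) (us k (m - 1) (Inr (Tau_plus, b))))
      - ?\<Phi> (us k m (Inr (Tau_minus, b)))))" for k m
  define right where "right k m = (\<Sum>b\<in>UNIV. weight x b * (?V k m Xi_plus b \<bullet>
      fs2 (us k m (Inr (Xi_plus, b))) (us (?next k) m (Inr (Xi_minus, b)))
      - ?\<psi> (us k m (Inr (Xi_plus, b)))))" for k m
  define left where "left k m = (\<Sum>b\<in>UNIV. weight x b * (?V k m Xi_minus b \<bullet>
      fs2 (us k m (Inr (Xi_minus, b))) (us (?prev k) m (Inr (Xi_plus, b)))
      - ?\<psi> (us k m (Inr (Xi_minus, b)))))" for k m

  have balance: "top k m - bottom k m + (right k m - left k m) = 0" if km: "k < Ks" "m < Kt" for k m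
  proof -
    have "jac X Y k m \<noteq> 0" and J1: "face_jac X Y k m \<noteq> 0"
      using dX[OF km(1)] dY[OF km(2)] by (auto simp: jac_def face_jac_def)
    then have inv: "invertible (mass y x (jac X Y k m))"
      using assms(6-9) by (intro mass_invertible) auto
    have coeffs: "v (us k m i) $ r =
      (vstack (sol_vol y x) (sol_face y x) *v (entropy_coeffs v y x (jac X Y k m) (uh k m) $ r)) $ i" for i r
      by (simp add: proj[OF km] projected_entropy_vars_def)
    have res: "residual fs2 ft2 u0 y x Ks Kt X Y us k m r = 0" for r
      using assms(12) km by (simp add: is_solution_def us_def)
    \<comment> \<open>Each face flux carries the factor \<open>face_jac X Y k m\<close>, as do the potentials, so it factors out of the balance.\<close>
    have scale: "(\<Sum>b\<in>UNIV. weight x b * (J1 * A b - J1 * P b)) = J1 * (\<Sum>b\<in>UNIV. weight x b * (A b - P b))"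
      for J1 :: real and A P :: "'q \<Rightarrow> real"
      unfolding sum_distrib_left by (intro sum.cong refl) (simp add: algebra_simps)
    have t: "(\<Sum>g\<in>UNIV. \<Sum>b\<in>UNIV. weight x b * normal_t g *
        (?V k m g b \<bullet> num_flux_t ft2 u0 x Kt X Y us k m (g, b) - face_jac X Y k m * ?\<Phi> (us k m (Inr (g, b)))))
      = face_jac X Y k m * top k m - face_jac X Y k m * bottom k m"
      by (simp add: sum_UNIV_face sum_negf scale top_def bottom_def del: if_split)
    have sp: "(\<Sum>g\<in>UNIV. \<Sum>b\<in>UNIV. weight x b * normal_s g *
        (?V k m g b \<bullet> num_flux_s fs2 Ks X Y us k m (g, b) - face_jac X Y k m * ?\<psi> (us k m (Inr (g, b)))))
      = face_jac X Y k m * right k m - face_jac X Y k m * left k m"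
      by (simp add: sum_UNIV_face sum_negf scale right_def left_def del: if_split)
    have "face_jac X Y k m * (top k m - bottom k m + (right k m - left k m)) = 0"
      using element_entropy_balance[where us = us and c = "\<lambda>r. entropy_coeffs v y x (jac X Y k m) (uh k m) $ r",
          OF inj inv ecs ect proj(1)[OF km] coeffs res]
      unfolding t sp by (simp only: distrib_left right_diff_distrib)
    then show ?thesis using J1 by simp
  qed
  have space: "right k m = left (?next k) m" if "k < Ks" "m < Kt" for k m
    unfolding right_def left_def using that Kpos
    by (intro sum.cong refl arg_cong[where f = "(*) _"])
      (subst interface_cancel[OF ecs], auto intro!: proj(1))
  have time: "top k m = bottom k (Suc m)" if "k < Ks" "Suc m < Kt" for k m
    unfolding top_def bottom_def using that
    by (intro sum.cong refl arg_cong[where f = "(*) _"])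
      (auto intro!: interface_cancel[OF ect] proj(1))

  \<comment> \<open>The face Jacobians of the intermediate timeslabs have dropped out here; those of the first and the
    last one, which enter the entropies, are all equal to \<open>J\<close>.\<close>
  have total: "(\<Sum>k<Ks. top k (Kt - 1)) = (\<Sum>k<Ks. bottom k 0)"
    by (rule grid_telescoping[where right = right and left = left, OF Kpos(2)])
      (rule balance space time; assumption)+

  define J where "J = face_jac X Y 0 0"
  have J: "face_jac X Y k 0 = J" "face_jac X Y k (Kt - 1) = J" if "k < Ks" for k
    using assms(5) that unfolding matching_face_jacs_def J_def by blast+
  have "top k (Kt - 1) = (\<Sum>b\<in>UNIV. weight x b * s (us k (Kt - 1) (Inr (Tau_plus, b))))" for k
    using Kpos(2) by (simp add: top_def temporal_potential_def)
  then have final: "final_entropy s x Ks Kt X Y us = J * (\<Sum>k<Ks. top k (Kt - 1))"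
    by (simp add: final_entropy_def J[simplified] sum_distrib_left mult_ac)
  have vs: "vs k (Inr (Tau_minus, b)) = ?V k 0 Tau_minus b" if "k < Ks" for k b
    using proj(2)[OF that Kpos(2)] by (simp add: vs_def)
  have "dirichlet_term s v ft2 u0 x Ks Kt X Y us vs - initial_entropy s u0 x Ks X Y
    = (\<Sum>k<Ks. - (J * bottom k 0))"
    unfolding dirichlet_term_def initial_entropy_def Let_def bottom_def sum_distrib_left
      sum_subtractf[symmetric] sum_negf[symmetric]
    by (intro sum.cong refl) (simp add: J vs temporal_potential_def inner_diff_left algebra_simps)
  then have "dirichlet_term s v ft2 u0 x Ks Kt X Y us vs - initial_entropy s u0 x Ks X Y
    = - (J * (\<Sum>k<Ks. bottom k 0))"
    by (simp add: sum_negf sum_distrib_left)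
  then have "final_entropy s x Ks Kt X Y us - initial_entropy s u0 x Ks X Y
    + dirichlet_term s v ft2 u0 x Ks Kt X Y us vs = 0"
    using final total by simp
  then show ?thesis unfolding us_def vs_def Let_def .
qed

end
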